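(* Let $t_c,t_g\ge 1$ be fixed integers. Suppose each $f_i$ ($1\le i\le n$) has $L_i$-Lipschitz continuous gradient and is $\mu_i$-strongly convex, let $L=\max_i L_i$, and let the steplength satisfy $0<\alpha\le\min\{\frac1L,c_4\}$, where $c_4=\frac{2}{\mu_{\bar f}+L_{\bar f}}$. Then the iterates generated by the NEAR-DGD$^{t_c,t_g}$ method satisfy, for all $k=0,1,2,\ldots$, $$\|\bar x_k-x^\star\|\le c_1^{kt_g}\|\bar x_0-x^\star\|+\frac{c_3\beta^{t_c}(\eta^{t_g}-1)}{1-c_1^{t_g}}+c_5\,\frac{\eta^{t_g}-1-t_g(\eta-1)}{1-c_1^{t_g}},$$ where $$c_1=\sqrt{1-\alpha c_2},\quad c_2=\frac{2\mu_{\bar f}L_{\bar f}}{\mu_{\bar f}+L_{\bar f}},\quad c_3=\frac{\alpha DL}{\eta-1},\quad c_5=\frac{\alpha M}{\eta-1},\quad \eta=1+\alpha L.$$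
   Context: Setting. $f_1,\dots,f_n:\mathbb{R}^p\to\mathbb{R}$ are convex differentiable functions; $L_i,\mu_i>0$ denote the Lipschitz constant of $\nabla f_i$ and the strong convexity constant of $f_i$. Norms are Euclidean (spectral for matrices). $\mathbf{W}\in\mathbb{R}^{n\times n}$ is the consensus matrix of a connected undirected graph on $\{1,\dots,n\}$: symmetric, doubly stochastic, $w_{ii}>0$, and for $i\ne j$, $w_{ij}>0$ if and only if $i,j$ are neighbors. It has exactly one eigenvalue equal to $1$, the others having absolute value strictly less than $1$; $\beta$, with $0<\beta<1$, is the second largest, in magnitude, eigenvalue of $\mathbf{W}$ (its absolute value). $\mathbf{Z}=\mathbf{W}\otimes I_p$. Method NEAR-DGD$^{t_c,t_g}$ with constant steplength $\alpha>0$. A vector in $\mathbb{R}^{np}$ is written as a concatenation of $n$ blocks in $\mathbb{R}^p$, e.g. $\mathbf{x}_k=[x_{1,k};\dots;x_{n,k}]$, and $\nabla\mathbf{f}(\mathbf{x})=[\nabla f_1(x_1);\dots;\nabla f_n(x_n)]$. Initialize $x_{i,0}=s_0$ for all $i$, with $s_0\in\mathbb{R}^p$ arbitrary. For $k\ge0$: $\mathbf{x}_k^0=\mathbf{x}_k$, $\mathbf{x}_k^j=\mathbf{x}_k^{j-1}-\alpha\nabla\mathbf{f}(\mathbf{x}_k^{j-1})$ for $j=1,\dots,t_g$, $\mathbf{y}_k=\mathbf{x}_k^{t_g}$, and $\mathbf{x}_{k+1}=\mathbf{Z}^{t_c}\mathbf{y}_k$. Average: $\bar x_k=\frac1n\sum_{i=1}^n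 x_{i,k}$. Constants. $x^\star\in\mathbb{R}^p$ is the minimizer of $\sum_{i=1}^n f_i$ over $\mathbb{R}^p$. $\bar f=\frac1n\sum_i f_i$, $\mu_{\bar f}=\frac1n\sum_i\mu_i$, $L_{\bar f}=\frac1n\sum_i L_i$. $u_i^\star=\arg\min_u f_i(u)$, $\mathbf{u}^\star=[u_1^\star;\dots;u_n^\star]$, $\gamma_i=\frac{\mu_iL_i}{\mu_i+L_i}$, $\gamma=\min_i\gamma_i$, $\nu=2\alpha\gamma$, $D=\|\mathbf{y}_0-\mathbf{u}^\star\|+\frac{\nu+4}{\nu}\|\mathbf{u}^\star\|$, $\widehat D=\|x^\star\|+\frac{D}{\sqrt n}$, $M=2L\widehat D+\sum_{i=1}^n\|\nabla f_i(x^\star)\|$. *)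

theory Defs
  imports
    "HOL-Analysis.Analysis"
    "HOL-Computational_Algebra.Polynomial"
begin

section \<open>Smooth and strongly convex functions\<close>

definition gradient :: "('a::real_inner \<Rightarrow> real) \<Rightarrow> 'a \<Rightarrow> 'a" where
  "gradient f x = (THE d. GDERIV f x :> d)"

definition strongly_convex :: "real \<Rightarrow> ('a::real_inner \<Rightarrow> real) \<Rightarrow> bool" where
  "strongly_convex \<mu> f \<longleftrightarrow>
     (\<forall>x y. \<forall>t\<in>{0..1}. f (t *\<^sub>R x + (1 - t) *\<^sub>R y)
        \<le> t * f x + (1 - t) * f y - \<mu> / 2 * t * (1 - t) * (norm (x - y))\<^sup>2)"

lemma gradient_eqI:
  assumes "GDERIV f x :> d"
  shows "gradient f x = d"
  unfolding gradient_def
proof (rule the_equality)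
  show "GDERIV f x :> d" by (fact assms)
next
  fix e assume "GDERIV f x :> e"
  then have "(\<lambda>h. inner h e) = (\<lambda>h. inner h d)"
    using assms unfolding gderiv_def by (rule has_derivative_unique)
  then have "inner (e - d) e = inner (e - d) d"
    by (rule fun_cong)
  then have "inner (e - d) (e - d) = 0"
    by (simp add: inner_diff_right)
  then show "e = d" by simp
qed

section \<open>Block vectors and matrices\<close>

text \<open>A vector consisting of one block in \<open>'k^'p\<close> for each index in \<open>'n\<close> is indexed by
  \<open>'n \<times> 'p\<close>.\<close>

definition stack :: "('n::finite \<Rightarrow> 'k^'p::finite) \<Rightarrow> 'k^('n \<times> 'p)" where
  "stack v = (\<chi> q. v (fst q) $ snd q)"

definition block :: "'k^('n::finite \<times> 'p::finite) \<Rightarrow> 'n \<Rightarrow> 'k^'p" where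
  "block x i = (\<chi> l. x $ (i, l))"

definition block_mean :: "real^('n::finite \<times> 'p::finite) \<Rightarrow> real^'p" where
  "block_mean x = (1 / real CARD('n)) *\<^sub>R (\<Sum>i\<in>UNIV. block x i)"

definition kronecker ::
  "'k::times^'b::finite^'a::finite \<Rightarrow> 'k^'d::finite^'c::finite \<Rightarrow> 'k^('b \<times> 'd)^('a \<times> 'c)" where
  "kronecker A B = (\<chi> q r. A $ fst q $ fst r * B $ snd q $ snd r)"

text \<open>The type class power on vectors is componentwise, so matrix powers need their own definition.\<close>

primrec matpow :: "'k::semiring_1^'n::finite^'n \<Rightarrow> nat \<Rightarrow> 'k^'n^'n" where
  "matpow A 0 = mat 1"
| "matpow A (Suc k) = A ** matpow A k"

lemma block_stack [simp]: "block (stack v) i = v i"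
  by (simp add: block_def stack_def vec_eq_iff)

lemma block_kronecker_mat_1:
  fixes W :: "real^'n::finite^'n" and x :: "real^('n \<times> 'p::finite)"
  shows "block (kronecker W (mat 1) *v x) i = (\<Sum>j\<in>UNIV. W $ i $ j *\<^sub>R block x j)"
proof -
  have "(\<Sum>r\<in>UNIV. W $ i $ fst r * (mat 1 :: real^'p^'p) $ l $ snd r * x $ r)
      = (\<Sum>j\<in>UNIV. W $ i $ j * x $ (j, l))" for l
  proof -
    have "(\<Sum>r\<in>UNIV. W $ i $ fst r * (mat 1 :: real^'p^'p) $ l $ snd r * x $ r)
        = (\<Sum>j\<in>UNIV. \<Sum>m\<in>UNIV. W $ i $ j * (mat 1 :: real^'p^'p) $ l $ m * x $ (j, m))"
      by (simp add: sum.cartesian_product case_prod_beta flip: UNIV_Times_UNIV)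
    also have "\<dots> = (\<Sum>j\<in>UNIV. W $ i $ j * x $ (j, l))"
    proof (rule sum.cong[OF refl])
      fix j
      have "(\<Sum>m\<in>UNIV. W $ i $ j * (mat 1 :: real^'p^'p) $ l $ m * x $ (j, m))
          = (\<Sum>m\<in>UNIV. if m = l then W $ i $ j * x $ (j, m) else 0)"
        by (rule sum.cong) (auto simp: mat_def)
      then show "(\<Sum>m\<in>UNIV. W $ i $ j * (mat 1 :: real^'p^'p) $ l $ m * x $ (j, m))
          = W $ i $ j * x $ (j, l)"
        by simp
    qed
    finally show ?thesis .
  qed
  then show ?thesis
    by (simp add: block_def kronecker_def matrix_vector_mult_def vec_eq_iff)
qed

section \<open>Consensus matrices\<close>

text \<open>The graph is given by its adjacency relation.\<close>

definition connected_graph :: "('n \<Rightarrow> 'n \<Rightarrow> bool) \<Rightarrow> bool" where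
  "connected_graph E \<longleftrightarrow> symp E \<and> irreflp E \<and> (\<forall>i j. E\<^sup>*\<^sup>* i j)"

definition doubly_stochastic :: "real^'n::finite^'n \<Rightarrow> bool" where
  "doubly_stochastic W \<longleftrightarrow> (\<forall>i j. 0 \<le> W $ i $ j)
     \<and> (\<forall>i. (\<Sum>j\<in>UNIV. W $ i $ j) = 1) \<and> (\<forall>j. (\<Sum>i\<in>UNIV. W $ i $ j) = 1)"

definition consensus_matrix :: "('n::finite \<Rightarrow> 'n \<Rightarrow> bool) \<Rightarrow> real^'n^'n \<Rightarrow> bool" where
  "consensus_matrix E W \<longleftrightarrow> transpose W = W \<and> doubly_stochastic W
     \<and> (\<forall>i. W $ i $ i > 0) \<and> (\<forall>i j. i \<noteq> j \<longrightarrow> (W $ i $ j > 0 \<longleftrightarrow> E i j))"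

definition charpoly :: "'k::comm_ring_1^'n::finite^'n \<Rightarrow> 'k poly" where
  "charpoly A = det (\<chi> i j. (if i = j then [:0, 1:] else 0) - [:A $ i $ j:])"

text \<open>Only real eigenvalues, counted with algebraic multiplicity; for a symmetric matrix
  these are all of its eigenvalues.\<close>

definition real_eigenvalues :: "real^'n::finite^'n \<Rightarrow> real multiset" where
  "real_eigenvalues A = proots (charpoly A)"

text \<open>The second entry of the list of the magnitudes in decreasing order. It is unspecified when
  there are fewer than two eigenvalues.\<close>

definition second_largest_eigenvalue_magnitude :: "real^'n::finite^'n \<Rightarrow> real" where
  "second_largest_eigenvalue_magnitude A =
     rev (sorted_list_of_multiset (image_mset abs (real_eigenvalues A))) ! 1"

section \<open>The method NEAR-DGD\<close>

definition gradient_step ::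
  "('n::finite \<Rightarrow> real^'p::finite \<Rightarrow> real) \<Rightarrow> real \<Rightarrow> real^('n \<times> 'p) \<Rightarrow> real^('n \<times> 'p)" where
  "gradient_step f \<alpha> x = x - \<alpha> *\<^sub>R stack (\<lambda>i. gradient (f i) (block x i))"

primrec near_dgd ::
  "('n::finite \<Rightarrow> real^'p::finite \<Rightarrow> real) \<Rightarrow> real^'n^'n \<Rightarrow> real \<Rightarrow> nat \<Rightarrow> nat \<Rightarrow> real^'p
     \<Rightarrow> nat \<Rightarrow> real^('n \<times> 'p)" where
  "near_dgd f W \<alpha> t\<^sub>c t\<^sub>g s\<^sub>0 0 = stack (\<lambda>_. s\<^sub>0)"
| "near_dgd f W \<alpha> t\<^sub>c t\<^sub>g s\<^sub>0 (Suc k) =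
     matpow (kronecker W (mat 1)) t\<^sub>c *v (gradient_step f \<alpha> ^^ t\<^sub>g) (near_dgd f W \<alpha> t\<^sub>c t\<^sub>g s\<^sub>0 k)"

definition near_dgd_y ::
  "('n::finite \<Rightarrow> real^'p::finite \<Rightarrow> real) \<Rightarrow> real^'n^'n \<Rightarrow> real \<Rightarrow> nat \<Rightarrow> nat \<Rightarrow> real^'p
     \<Rightarrow> nat \<Rightarrow> real^('n \<times> 'p)" where
  "near_dgd_y f W \<alpha> t\<^sub>c t\<^sub>g s\<^sub>0 k = (gradient_step f \<alpha> ^^ t\<^sub>g) (near_dgd f W \<alpha> t\<^sub>c t\<^sub>g s\<^sub>0 k)"

end

(*
  The mean of the blocks follows an inexact gradient method for the average function: each local
  step contracts the distance to the minimizer by c_1, up to alpha L times the mean distance of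
  the blocks to their average (the dispersion). The dispersion grows by a factor eta per local
  step plus a term for the disagreement of the local gradients, and after a consensus round it is
  at most beta^t_c times the norm of the iterate. Summing these errors geometrically gives the
  bound.

  For k >= 1 the iterates have norm at most D, which bounds the gradient disagreement by M. The
  initial point may be arbitrarily large compared with D, however, and the first outer iteration
  needs an argument of its own. Its initial dispersion is 0. Either the last term of the bound
  exceeds the distance of the mean of y_0 to x_star, or t = alpha L is small. In the latter case
  norm (x - u_star) <= (1 - t)^(-t_g) norm (y_0 - u_star) for all local iterates x leading to y_0,
  and 1 - c_1^t_g <= 2 (1 - t)^t_g, so the denominator 1 - c_1^t_g absorbs the enlarged gradient
  disagreement.
*)

theory Submission
  imports Defs
begin

section \<open>Convex functions with Lipschitz gradients\<close>

lemma power2_norm_diff_scaleR: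
  fixes a b :: "'a::real_inner"
  shows "(norm (a - c *\<^sub>R b))\<^sup>2 = (norm a)\<^sup>2 - 2 * c * inner a b + c\<^sup>2 * (norm b)\<^sup>2"
  unfolding power2_norm_eq_inner
  by (simp add: inner_diff_left inner_diff_right inner_commute power2_eq_square)

lemma GDERIV_gradient:
  fixes f :: "'a::euclidean_space \<Rightarrow> real"
  assumes "f differentiable (at x)"
  shows "GDERIV f x :> gradient f x"
proof -
  obtain f' where f': "(f has_derivative f') (at x)"
    using assms unfolding differentiable_def by blast
  then have "linear f'" by (rule has_derivative_linear)
  then have "f' h = inner h (adjoint f' 1)" for h
    using adjoint_works[of f' h 1] by (simp add: inner_commute)
  then have "f' = (\<lambda>h. inner h (adjoint f' 1))" by blast
  then have "GDERIV f x :> adjoint f' 1"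
    unfolding gderiv_def using f' by metis
  then show ?thesis by (metis gradient_eqI)
qed

lemma DERIV_along_line:
  fixes f :: "'a::euclidean_space \<Rightarrow> real"
  assumes "f differentiable (at (x + t *\<^sub>R d))"
  shows "((\<lambda>s. f (x + s *\<^sub>R d)) has_real_derivative inner d (gradient f (x + t *\<^sub>R d))) (at t)"
proof -
  have "((\<lambda>s. x + s *\<^sub>R d) has_derivative (\<lambda>s. s *\<^sub>R d)) (at t)"
    by (auto intro!: derivative_eq_intros)
  moreover have "(f has_derivative (\<lambda>h. inner h (gradient f (x + t *\<^sub>R d)))) (at (x + t *\<^sub>R d))"
    using GDERIV_gradient[OF assms] unfolding gderiv_def .
  ultimately have "((\<lambda>s. f (x + s *\<^sub>R d)) has_derivative
      (\<lambda>s. inner (s *\<^sub>R d) (gradient f (x + t *\<^sub>R d)))) (at t)"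
    by (rule has_derivative_compose)
  then show ?thesis
    unfolding has_field_derivative_def by (simp add: mult_commute_abs)
qed

definition bregman_bounds :: "real \<Rightarrow> real \<Rightarrow> ('a::real_inner \<Rightarrow> real) \<Rightarrow> ('a \<Rightarrow> 'a) \<Rightarrow> bool" where
  "bregman_bounds \<mu> L f G \<longleftrightarrow> (\<forall>x y.
     \<mu> / 2 * (norm (y - x))\<^sup>2 \<le> f y - f x - inner (G x) (y - x) \<and>
     f y - f x - inner (G x) (y - x) \<le> L / 2 * (norm (y - x))\<^sup>2)"

lemma strongly_convex_above_tangent:
  fixes f :: "'a::euclidean_space \<Rightarrow> real"
  assumes "strongly_convex \<mu> f" and "f differentiable (at x)"
  shows "\<mu> / 2 * (norm (y - x))\<^sup>2 \<le> f y - f x - inner (gradient f x) (y - x)"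
proof -
  define d where "d = y - x"
  have slope: "(f (x + t *\<^sub>R d) - f x) / t \<le> f y - f x - \<mu> / 2 * (1 - t) * (norm d)\<^sup>2"
    if t: "0 < t" "t \<le> 1" for t
  proof -
    have *: "t *\<^sub>R y + (1 - t) *\<^sub>R x = x + t *\<^sub>R d"
      by (simp add: d_def algebra_simps)
    have "f (t *\<^sub>R y + (1 - t) *\<^sub>R x)
        \<le> t * f y + (1 - t) * f x - \<mu> / 2 * t * (1 - t) * (norm (y - x))\<^sup>2"
      using assms(1) t unfolding strongly_convex_def by simp
    then have "f (x + t *\<^sub>R d) - f x \<le> (f y - f x - \<mu> / 2 * (1 - t) * (norm d)\<^sup>2) * t"
      unfolding * d_def[symmetric] by (simp add: algebra_simps)
    then show ?thesis using t by (simp add: pos_divide_le_eq)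
  qed
  have "((\<lambda>t. f (x + t *\<^sub>R d)) has_real_derivative inner d (gradient f x)) (at 0)"
    using DERIV_along_line[of f x 0 d] assms(2) by simp
  then have lim: "((\<lambda>t. (f (x + t *\<^sub>R d) - f x) / t) \<longlongrightarrow> inner d (gradient f x)) (at_right 0)"
    unfolding DERIV_def by (auto intro: tendsto_within_subset)
  have lim': "((\<lambda>t. f y - f x - \<mu> / 2 * (1 - t) * (norm d)\<^sup>2) \<longlongrightarrow>
      f y - f x - \<mu> / 2 * (1 - 0) * (norm d)\<^sup>2) (at_right 0)"
    by (intro tendsto_intros)
  have "eventually (\<lambda>t::real. t \<in> {0<..<1}) (at_right 0)"
    by (rule eventually_at_right_real) simp
  then have "eventually (\<lambda>t. (f (x + t *\<^sub>R d) - f x) / t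
      \<le> f y - f x - \<mu> / 2 * (1 - t) * (norm d)\<^sup>2) (at_right 0)"
    by eventually_elim (rule slope; simp)
  then have "inner d (gradient f x) \<le> f y - f x - \<mu> / 2 * (1 - 0) * (norm d)\<^sup>2"
    by (intro tendsto_le[OF _ lim' lim]) auto
  then show ?thesis by (simp add: d_def inner_commute)
qed

lemma lipschitz_gradient_below_parabola:
  fixes f :: "'a::euclidean_space \<Rightarrow> real"
  assumes "\<And>x. f differentiable (at x)" and "L-lipschitz_on UNIV (gradient f)"
  shows "f y - f x - inner (gradient f x) (y - x) \<le> L / 2 * (norm (y - x))\<^sup>2"
proof -
  define d where "d = y - x"
  define \<psi> where "\<psi> t = f (x + t *\<^sub>R d) - t * inner (gradient f x) d - L / 2 * t\<^sup>2 * (norm d)\<^sup>2" for t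
  have "\<exists>D. (\<psi> has_real_derivative D) (at t) \<and> D \<le> 0" if "0 \<le> t" for t
  proof (intro exI conjI)
    show "(\<psi> has_real_derivative (inner d (gradient f (x + t *\<^sub>R d)) - inner (gradient f x) d
        - L * t * (norm d)\<^sup>2)) (at t)"
      unfolding \<psi>_def
      by (rule derivative_eq_intros DERIV_along_line assms refl | simp)+
    have "inner d (gradient f (x + t *\<^sub>R d)) - inner (gradient f x) d
        = inner d (gradient f (x + t *\<^sub>R d) - gradient f x)"
      by (simp add: inner_diff_right inner_commute)
    also have "\<dots> \<le> norm d * norm (gradient f (x + t *\<^sub>R d) - gradient f x)"
      by (rule norm_cauchy_schwarz)
    also have "\<dots> \<le> norm d * (L * norm (t *\<^sub>R d))"
      using lipschitz_onD[OF assms(2), of "x + t *\<^sub>R d" x]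
      by (intro mult_left_mono) (simp_all add: dist_norm)
    finally show "inner d (gradient f (x + t *\<^sub>R d)) - inner (gradient f x) d
        - L * t * (norm d)\<^sup>2 \<le> 0"
      using that by (simp add: power2_eq_square mult_ac)
  qed
  then have "\<psi> 1 \<le> \<psi> 0"
    using DERIV_nonpos_imp_nonincreasing[of 0 1 \<psi>] by simp
  then have "f (x + d) - inner (gradient f x) d - L / 2 * (norm d)\<^sup>2 \<le> f x"
    unfolding \<psi>_def by simp
  then show ?thesis by (simp add: d_def algebra_simps)
qed

lemma bregman_bounds_gradient:
  fixes f :: "'a::euclidean_space \<Rightarrow> real"
  assumes "strongly_convex \<mu> f" "\<And>x. f differentiable (at x)" "L-lipschitz_on UNIV (gradient f)"
  shows "bregman_bounds \<mu> L f (gradient f)"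
  unfolding bregman_bounds_def
  using strongly_convex_above_tangent[OF assms(1,2)]
    lipschitz_gradient_below_parabola[OF assms(2,3)] by blast

lemma bregman_bounds_mono:
  fixes f :: "'a::real_inner \<Rightarrow> real"
  assumes "bregman_bounds \<mu> L f G" "\<mu>' \<le> \<mu>" "L \<le> L'"
  shows "bregman_bounds \<mu>' L' f G"
  unfolding bregman_bounds_def
proof (intro allI conjI)
  fix x y :: 'a
  have "\<mu>' / 2 * (norm (y - x))\<^sup>2 \<le> \<mu> / 2 * (norm (y - x))\<^sup>2"
    "L / 2 * (norm (y - x))\<^sup>2 \<le> L' / 2 * (norm (y - x))\<^sup>2"
    using assms by (auto intro!: mult_right_mono)
  moreover have "\<mu> / 2 * (norm (y - x))\<^sup>2 \<le> f y - f x - inner (G x) (y - x)"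
    "f y - f x - inner (G x) (y - x) \<le> L / 2 * (norm (y - x))\<^sup>2"
    using assms(1) unfolding bregman_bounds_def by auto
  ultimately show "\<mu>' / 2 * (norm (y - x))\<^sup>2 \<le> f y - f x - inner (G x) (y - x)"
    "f y - f x - inner (G x) (y - x) \<le> L' / 2 * (norm (y - x))\<^sup>2"
    by linarith+
qed

lemma bregman_bounds_le:
  fixes f :: "'a::euclidean_space \<Rightarrow> real"
  assumes "bregman_bounds \<mu> L f G"
  shows "\<mu> \<le> L"
proof -
  obtain b :: 'a where "b \<in> Basis" using nonempty_Basis by blast
  then have "norm (b - 0) = 1" by simp
  moreover have "\<mu> / 2 * (norm (b - 0))\<^sup>2 \<le> L / 2 * (norm (b - 0))\<^sup>2"
    using assms unfolding bregman_bounds_def by (meson order_trans)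
  ultimately show ?thesis by simp
qed

lemma bregman_bounds_sum:
  assumes "finite I" "\<And>i. i \<in> I \<Longrightarrow> bregman_bounds (\<mu> i) (L i) (f i) (G i)"
  shows "bregman_bounds (\<Sum>i\<in>I. \<mu> i) (\<Sum>i\<in>I. L i) (\<lambda>x. \<Sum>i\<in>I. f i x) (\<lambda>x. \<Sum>i\<in>I. G i x)"
proof -
  have *: "(\<Sum>i\<in>I. f i y) - (\<Sum>i\<in>I. f i x) - inner (\<Sum>i\<in>I. G i x) (y - x)
      = (\<Sum>i\<in>I. f i y - f i x - inner (G i x) (y - x))" for x y
    by (simp add: sum_subtractf inner_sum_left)
  show ?thesis
    using assms(2) unfolding bregman_bounds_def * sum_divide_distrib sum_distrib_right
    by (auto intro!: sum_mono)
qed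

lemma bregman_bounds_scale:
  assumes "bregman_bounds \<mu> L f G" "0 \<le> c"
  shows "bregman_bounds (c * \<mu>) (c * L) (\<lambda>x. c * f x) (\<lambda>x. c *\<^sub>R G x)"
proof -
  have *: "c * f y - c * f x - inner (c *\<^sub>R G x) (y - x)
      = c * (f y - f x - inner (G x) (y - x))" for x y
    by (simp add: algebra_simps)
  show ?thesis
    using assms unfolding bregman_bounds_def *
    by (simp add: mult.assoc mult_left_mono flip: times_divide_eq_right)
qed

lemma bregman_bounds_shift:
  assumes "bregman_bounds \<mu> L f G"
  shows "bregman_bounds 0 (L - \<mu>) (\<lambda>x. f x - \<mu> / 2 * (norm x)\<^sup>2) (\<lambda>x. G x - \<mu> *\<^sub>R x)"
proof -
  have *: "(f y - \<mu> / 2 * (norm y)\<^sup>2) - (f x - \<mu> / 2 * (norm x)\<^sup>2) - inner (G x - \<mu> *\<^sub>R x) (y - x)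
      = (f y - f x - inner (G x) (y - x)) - \<mu> / 2 * (norm (y - x))\<^sup>2" for x y
    by (simp add: power2_norm_eq_inner inner_diff_left inner_diff_right inner_commute field_simps)
  show ?thesis
    using assms unfolding bregman_bounds_def * by (simp add: algebra_simps diff_divide_distrib)
qed

lemma cocoercive:
  fixes f :: "'a::real_inner \<Rightarrow> real"
  assumes "bregman_bounds 0 K f G" "0 < K"
  shows "(norm (G x - G y))\<^sup>2 \<le> K * inner (G x - G y) (x - y)"
proof -
  have half: "(norm (G x - G y))\<^sup>2 / (2 * K) \<le> f y - f x - inner (G x) (y - x)" for x y
  proof -
    define g where "g = G x - G y"
    define z where "z = y + (1 / K) *\<^sub>R g"
    have "0 \<le> f z - f x - inner (G x) (z - x)"
      "f z - f y - inner (G y) (z - y) \<le> K / 2 * (norm (z - y))\<^sup>2"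
      using assms(1) unfolding bregman_bounds_def by auto
    moreover have "K / 2 * (norm (z - y))\<^sup>2 = (norm g)\<^sup>2 / (2 * K)"
      using assms(2) by (simp add: z_def power2_eq_square field_simps)
    moreover have "inner (G x) (z - x) - inner (G y) (z - y) = inner (G x) (y - x) + inner g (z - y)"
      by (simp add: g_def inner_diff_left inner_diff_right)
    moreover have "inner g (z - y) = 2 * ((norm g)\<^sup>2 / (2 * K))"
      using assms(2) by (simp add: z_def power2_norm_eq_inner field_simps)
    ultimately show ?thesis unfolding g_def[symmetric] by linarith
  qed
  have "(norm (G x - G y))\<^sup>2 / (2 * K) + (norm (G x - G y))\<^sup>2 / (2 * K)
      \<le> inner (G x - G y) (x - y)"
    using half[of x y] half[of y x]
    by (simp add: norm_minus_commute inner_diff_left inner_diff_right)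
  then show ?thesis using assms(2) by (simp add: field_simps)
qed

lemma strongly_convex_cocoercive:
  fixes f :: "'a::real_inner \<Rightarrow> real"
  assumes "bregman_bounds \<mu> L f G" "\<mu> \<le> L"
  shows "(norm (G x - G y))\<^sup>2 + \<mu> * L * (norm (x - y))\<^sup>2 \<le> (\<mu> + L) * inner (G x - G y) (x - y)"
proof -
  define g where "g = (G x - G y) - \<mu> *\<^sub>R (x - y)"
  have "(norm g)\<^sup>2 \<le> K * inner g (x - y)" if "K > 0" "L - \<mu> \<le> K" for K
  proof -
    have "bregman_bounds 0 K (\<lambda>x. f x - \<mu> / 2 * (norm x)\<^sup>2) (\<lambda>x. G x - \<mu> *\<^sub>R x)"
      using bregman_bounds_mono[OF bregman_bounds_shift[OF assms(1)]] that by simp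
    from cocoercive[OF this that(1), of x y] show ?thesis
      by (simp add: g_def algebra_simps)
  qed
  note * = this
  have "((\<lambda>e. (L - \<mu> + e) * inner g (x - y)) \<longlongrightarrow> (L - \<mu> + 0) * inner g (x - y)) (at_right 0)"
    by (intro tendsto_intros)
  moreover have "eventually (\<lambda>e. (norm g)\<^sup>2 \<le> (L - \<mu> + e) * inner g (x - y)) (at_right 0)"
    using eventually_at_right_less[of 0] by eventually_elim (rule *; use assms(2) in simp)
  ultimately have "(norm g)\<^sup>2 \<le> (L - \<mu> + 0) * inner g (x - y)"
    by (intro tendsto_lowerbound) auto
  moreover have "(norm g)\<^sup>2 = (norm (G x - G y))\<^sup>2 - 2 * \<mu> * inner (G x - G y) (x - y) + \<mu>\<^sup>2 * (norm (x - y))\<^sup>2"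
    unfolding g_def power2_norm_diff_scaleR ..
  moreover have "inner g (x - y) = inner (G x - G y) (x - y) - \<mu> * (norm (x - y))\<^sup>2"
    unfolding g_def power2_norm_eq_inner
    by (simp only: inner_diff_left[of "G x - G y"] inner_scaleR_left)
  moreover have "A + \<mu> * L * n \<le> (\<mu> + L) * p"
    if "A - 2 * \<mu> * p + \<mu>\<^sup>2 * n \<le> (L - \<mu> + 0) * (p - \<mu> * n)" for A n p :: real
    using that by (simp add: algebra_simps power2_eq_square)
  ultimately show ?thesis by simp
qed

lemma gradient_step_contraction:
  fixes f :: "'a::real_inner \<Rightarrow> real"
  assumes "bregman_bounds \<mu> L f G" "0 < \<mu>" "\<mu> \<le> L" "0 \<le> \<alpha>" "\<alpha> \<le> 2 / (\<mu> + L)"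
  shows "(norm ((x - \<alpha> *\<^sub>R G x) - (y - \<alpha> *\<^sub>R G y)))\<^sup>2
    \<le> (1 - \<alpha> * (2 * \<mu> * L / (\<mu> + L))) * (norm (x - y))\<^sup>2"
proof -
  define g d where "g = G x - G y" and "d = x - y"
  have s: "\<mu> + L > 0" using assms by simp
  have "((norm g)\<^sup>2 + \<mu> * L * (norm d)\<^sup>2) / (\<mu> + L) \<le> inner g d"
    using strongly_convex_cocoercive[OF assms(1,3), of x y] s
    by (simp add: g_def d_def field_simps)
  then have 1: "2 * \<alpha> * (((norm g)\<^sup>2 + \<mu> * L * (norm d)\<^sup>2) / (\<mu> + L)) \<le> 2 * \<alpha> * inner g d"
    using assms(4) by (intro mult_left_mono) auto
  have 2: "\<alpha> * \<alpha> * (norm g)\<^sup>2 \<le> \<alpha> * (2 / (\<mu> + L)) * (norm g)\<^sup>2"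
    using assms(4,5) by (intro mult_right_mono mult_left_mono) auto
  have "(x - \<alpha> *\<^sub>R G x) - (y - \<alpha> *\<^sub>R G y) = d - \<alpha> *\<^sub>R g"
    by (simp add: g_def d_def algebra_simps)
  then have "(norm ((x - \<alpha> *\<^sub>R G x) - (y - \<alpha> *\<^sub>R G y)))\<^sup>2
      = (norm d)\<^sup>2 - 2 * \<alpha> * inner g d + \<alpha> * \<alpha> * (norm g)\<^sup>2"
    by (simp only: power2_norm_diff_scaleR inner_commute[of d g] power2_eq_square[of \<alpha>])
  also have "\<dots> \<le> (norm d)\<^sup>2 - 2 * \<alpha> * (((norm g)\<^sup>2 + \<mu> * L * (norm d)\<^sup>2) / (\<mu> + L))
      + \<alpha> * (2 / (\<mu> + L)) * (norm g)\<^sup>2"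
    by (intro add_mono diff_mono order_refl 1 2)
  also have "\<dots> = (1 - \<alpha> * (2 * \<mu> * L / (\<mu> + L))) * (norm d)\<^sup>2"
    by (simp add: add_divide_distrib algebra_simps)
  finally show ?thesis by (simp add: d_def)
qed

lemma minimizer_imp_zero_gradient:
  fixes f :: "'a::real_inner \<Rightarrow> real"
  assumes "bregman_bounds \<mu> L f G" "0 < L" "is_arg_min f (\<lambda>_. True) x"
  shows "G x = 0"
proof -
  define y where "y = x - (1 / L) *\<^sub>R G x"
  have "f y - f x - inner (G x) (y - x) \<le> L / 2 * (norm (y - x))\<^sup>2"
    using assms(1) unfolding bregman_bounds_def by blast
  moreover have "f x \<le> f y"
    using assms(3) by (simp add: is_arg_min_linorder)
  moreover have "inner (G x) (y - x) = - (norm (G x))\<^sup>2 / L"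
    by (simp add: y_def power2_norm_eq_inner)
  moreover have "L / 2 * (norm (y - x))\<^sup>2 = (norm (G x))\<^sup>2 / (2 * L)"
    using assms(2) by (simp add: y_def power2_eq_square field_simps)
  ultimately have "(norm (G x))\<^sup>2 / L \<le> (norm (G x))\<^sup>2 / (2 * L)" by linarith
  then have "(norm (G x))\<^sup>2 \<le> 0"
    using assms(2) by (simp add: field_simps)
  then show ?thesis by simp
qed

text \<open>Cocoercivity places the increment of the gradient in the ball with centre \<open>(L / 2) d\<close> and
  radius \<open>(L / 2) * norm d\<close>, where \<open>d\<close> is the increment of the argument; hence two such
  increments differ by at most \<open>L * norm d\<close>, and not just \<open>2 * L * norm d\<close>.\<close>

lemma cocoercive_ball:
  fixes f :: "'a::real_inner \<Rightarrow> real"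
  assumes "bregman_bounds 0 L f G" "0 < L"
  shows "norm (G x - G y - (L / 2) *\<^sub>R (x - y)) \<le> L / 2 * norm (x - y)"
proof (rule power2_le_imp_le)
  define g d where "g = G x - G y" and "d = x - y"
  have "(norm (g - (L / 2) *\<^sub>R d))\<^sup>2 = (norm g)\<^sup>2 - L * inner g d + (L / 2 * norm d)\<^sup>2"
    unfolding power2_norm_diff_scaleR power_mult_distrib[of _ "norm d"] by simp
  then show "(norm (G x - G y - (L / 2) *\<^sub>R (x - y)))\<^sup>2 \<le> (L / 2 * norm (x - y))\<^sup>2"
    using cocoercive[OF assms, of x y] by (simp add: g_def d_def)
qed (use assms in auto)

section \<open>Consensus averaging\<close>

lemma inner_eq_sum_block: "inner x y = (\<Sum>i\<in>UNIV. inner (block x i) (block y i))"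
  for x y :: "real^('n::finite \<times> 'p::finite)"
  by (simp add: inner_vec_def block_def sum.cartesian_product case_prod_beta flip: UNIV_Times_UNIV)

lemma power2_norm_eq_sum_block: "(norm x)\<^sup>2 = (\<Sum>i\<in>UNIV. (norm (block x i))\<^sup>2)"
  for x :: "real^('n::finite \<times> 'p::finite)"
  by (simp add: power2_norm_eq_inner inner_eq_sum_block)

lemma block_vector_eqI: "(\<And>i. block x i = block y i) \<Longrightarrow> x = y"
  by (simp add: block_def vec_eq_iff)

lemma block_0 [simp]: "block (0 :: real^('n::finite \<times> 'p::finite)) i = 0"
  by (simp add: block_def vec_eq_iff)

lemma block_add [simp]: "block (x + y) i = block x i + block y i"
  and block_diff [simp]: "block (x - y) i = block x i - block y i"
  and block_scaleR [simp]: "block (c *\<^sub>R x) i = c *\<^sub>R block x i"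
  for x y :: "real^('n::finite \<times> 'p::finite)"
  by (simp_all add: block_def vec_eq_iff)

lemma block_mean_add: "block_mean (x + y) = block_mean x + block_mean y"
  and block_mean_diff: "block_mean (x - y) = block_mean x - block_mean y"
  and block_mean_scaleR: "block_mean (c *\<^sub>R x) = c *\<^sub>R block_mean x"
  by (simp_all add: block_mean_def sum.distrib sum_subtractf scaleR_sum_right[symmetric]
      algebra_simps)

lemma block_mean_stack_const [simp]: "block_mean (stack (\<lambda>_. c) :: real^('n::finite \<times> 'p::finite)) = c"
  by (simp add: block_mean_def sum_constant_scaleR del: sum_constant)

lemma mean_norm_block_le:
  fixes x :: "real^('n::finite \<times> 'p::finite)"
  shows "(\<Sum>i\<in>UNIV. norm (block x i)) / real CARD('n) \<le> norm x / sqrt (real CARD('n))"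
proof -
  define n where "n = real CARD('n)"
  have n: "n > 0" by (simp add: n_def)
  have "(\<Sum>i\<in>UNIV. norm (block x i))\<^sup>2 \<le> (norm x)\<^sup>2 * n"
    using sum_squared_le_sum_of_squares[of "\<lambda>i. norm (block x i)" UNIV]
    by (simp add: power2_norm_eq_sum_block n_def)
  also have "\<dots> = (norm x * sqrt n)\<^sup>2"
    using n by (simp add: power_mult_distrib)
  finally have "(\<Sum>i\<in>UNIV. norm (block x i)) \<le> norm x * sqrt n"
    by (rule power2_le_imp_le) (use n in simp)
  then have "(\<Sum>i\<in>UNIV. norm (block x i)) / n \<le> norm x * sqrt n / n"
    using n by (intro divide_right_mono) auto
  also have "\<dots> = norm x * (sqrt n / n)" by simp
  also have "\<dots> = norm x / sqrt n"
    using n by (simp add: sqrt_divide_self_eq divide_inverse[of "norm x" "sqrt n"])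
  finally show ?thesis by (simp add: n_def)
qed

lemma norm_block_mean_le:
  fixes x :: "real^('n::finite \<times> 'p::finite)"
  shows "norm (block_mean x) \<le> norm x / sqrt (real CARD('n))"
proof -
  have "norm (block_mean x) \<le> (\<Sum>i\<in>UNIV. norm (block x i)) / real CARD('n)"
    unfolding block_mean_def by (simp add: norm_sum divide_right_mono)
  then show ?thesis using mean_norm_block_le[of x] by linarith
qed

lemma norm_diff_block_mean_le:
  fixes x :: "real^('n::finite \<times> 'p::finite)"
  shows "norm (x - stack (\<lambda>_. block_mean x)) \<le> norm x"
proof (rule power2_le_imp_le)
  define m :: "real^('n \<times> 'p)" where "m = stack (\<lambda>_. block_mean x)"
  have "inner (x - m) m = inner ((\<Sum>i\<in>UNIV. block x i) - real CARD('n) *\<^sub>R block_mean x) (block_mean x)"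
    by (simp add: m_def inner_eq_sum_block inner_sum_left inner_diff_left sum_subtractf)
  also have "\<dots> = 0" by (simp add: block_mean_def)
  finally have "(norm ((x - m) + m))\<^sup>2 = (norm (x - m))\<^sup>2 + (norm m)\<^sup>2"
    using norm_add_Pythagorean[of "x - m" m] by (simp add: orthogonal_def)
  then show "(norm (x - stack (\<lambda>_. block_mean x)))\<^sup>2 \<le> (norm x)\<^sup>2"
    by (simp add: m_def)
qed simp

text \<open>A maximizer \<open>v\<close> of \<open>norm (T v)\<close> on the unit sphere of \<open>S\<close>, with maximum \<open>\<sigma>\<close>, satisfies
  \<open>T (T v) = \<sigma>\<^sup>2 v\<close>. So \<open>v\<close> is an eigenvector for \<open>- \<sigma>\<close> or \<open>T v + \<sigma> v\<close> is one for \<open>\<sigma>\<close>.\<close>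

lemma self_adjoint_norm_le:
  fixes T :: "'a::euclidean_space \<Rightarrow> 'a"
  assumes lin: "linear T" and adj: "\<And>x y. inner (T x) y = inner x (T y)"
    and S: "subspace S" and inv: "\<And>x. x \<in> S \<Longrightarrow> T x \<in> S"
    and eig: "\<And>\<theta> w. w \<in> S \<Longrightarrow> w \<noteq> 0 \<Longrightarrow> T w = \<theta> *\<^sub>R w \<Longrightarrow> \<bar>\<theta>\<bar> \<le> \<beta>"
    and x: "x \<in> S"
  shows "norm (T x) \<le> \<beta> * norm x"
proof (cases "x = 0")
  case True
  then show ?thesis using lin by (simp add: linear_0)
next
  case False
  have T_scale: "T (c *\<^sub>R w) = c *\<^sub>R T w" for c w
    by (rule linear_cmul[OF lin])
  have normalize: "w /\<^sub>R norm w \<in> S \<inter> sphere 0 1" if "w \<in> S" "w \<noteq> 0" for w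
    using that S by (simp add: subspace_scale)
  have "compact (S \<inter> sphere 0 1)"
    by (simp add: closed_Int_compact closed_subspace S)
  moreover have "S \<inter> sphere 0 1 \<noteq> {}"
    using normalize[OF x False] by blast
  moreover have "continuous_on (S \<inter> sphere 0 1) (\<lambda>v. norm (T v))"
    using lin by (intro continuous_on_norm linear_continuous_on) (simp add: linear_linear)
  ultimately obtain v where v: "v \<in> S" "norm v = 1"
    and max: "\<And>w. w \<in> S \<inter> sphere 0 1 \<Longrightarrow> norm (T w) \<le> norm (T v)"
    using continuous_attains_sup[of "S \<inter> sphere 0 1" "\<lambda>v. norm (T v)"]
    by (metis Int_iff mem_sphere_0)
  define \<sigma> where "\<sigma> = norm (T v)"
  have bound: "norm (T w) \<le> \<sigma> * norm w" if "w \<in> S" for w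
  proof (cases "w = 0")
    case True
    then show ?thesis using lin by (simp add: linear_0)
  next
    case False
    then show ?thesis
      using max[OF normalize[OF that False]] by (simp add: T_scale \<sigma>_def field_simps)
  qed
  have "(norm (T (T v)))\<^sup>2 \<le> (\<sigma> * \<sigma>)\<^sup>2"
    using bound[OF inv[OF v(1)]] by (intro power_mono) (auto simp: \<sigma>_def)
  moreover have "inner (T (T v)) v = \<sigma>\<^sup>2"
    by (simp add: adj \<sigma>_def power2_norm_eq_inner)
  ultimately have "(norm (T (T v) - \<sigma>\<^sup>2 *\<^sub>R v))\<^sup>2 \<le> 0"
    unfolding power2_norm_diff_scaleR v(2) by (simp add: power2_eq_square)
  then have TT: "T (T v) = \<sigma>\<^sup>2 *\<^sub>R v" by simp
  have "\<sigma> \<le> \<beta>"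
  proof (cases "T v + \<sigma> *\<^sub>R v = 0")
    case True
    then have "T v = (- \<sigma>) *\<^sub>R v" by (simp add: add_eq_0_iff)
    moreover have "v \<noteq> 0" using v(2) by auto
    ultimately show ?thesis using eig[OF v(1)] by fastforce
  next
    case False
    have "T (T v + \<sigma> *\<^sub>R v) = \<sigma> *\<^sub>R (T v + \<sigma> *\<^sub>R v)"
      by (simp add: linear_add[OF lin] T_scale TT power2_eq_square algebra_simps)
    moreover have "T v + \<sigma> *\<^sub>R v \<in> S"
      using v(1) inv S by (simp add: subspace_add subspace_scale)
    ultimately show ?thesis using eig False by fastforce
  qed
  then have "\<sigma> * norm x \<le> \<beta> * norm x" by (rule mult_right_mono) simp
  then show ?thesis using bound[OF x] by linarith
qed

lemma stochastic_eigenvalue_le_1: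
  fixes W :: "real^'n::finite^'n"
  assumes W: "doubly_stochastic W" and "W *v v = \<theta> *\<^sub>R v" and "v \<noteq> 0"
  shows "\<bar>\<theta>\<bar> \<le> 1"
proof -
  have "Max (range (\<lambda>j. \<bar>v $ j\<bar>)) \<in> range (\<lambda>j. \<bar>v $ j\<bar>)"
    by (rule Max_in) auto
  then obtain i where i: "\<bar>v $ i\<bar> = Max (range (\<lambda>j. \<bar>v $ j\<bar>))" by (elim imageE) simp
  have max: "\<bar>v $ j\<bar> \<le> \<bar>v $ i\<bar>" for j
    unfolding i by (rule Max_ge) auto
  obtain j where "v $ j \<noteq> 0" using assms(3) by (auto simp: vec_eq_iff)
  then have pos: "\<bar>v $ i\<bar> > 0" using max[of j] by linarith
  have "\<bar>\<theta>\<bar> * \<bar>v $ i\<bar> = \<bar>\<Sum>j\<in>UNIV. W $ i $ j * v $ j\<bar>"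
    using arg_cong[OF assms(2), of "\<lambda>u. \<bar>u $ i\<bar>"] by (simp add: matrix_vector_mult_def abs_mult)
  also have "\<dots> \<le> (\<Sum>j\<in>UNIV. W $ i $ j * \<bar>v $ i\<bar>)"
    using W max unfolding doubly_stochastic_def
    by (intro order_trans[OF sum_abs] sum_mono) (simp add: abs_mult mult_left_mono)
  also have "\<dots> = 1 * \<bar>v $ i\<bar>"
    using W by (simp add: doubly_stochastic_def flip: sum_distrib_right)
  finally show ?thesis using pos by simp
qed

lemma poly_charpoly: "poly (charpoly A) x = det (mat x - A)"
proof -
  have "poly (of_int k) x = of_int k" for k :: int and x :: 'a
    by (simp add: of_int_poly)
  then show ?thesis
    unfolding charpoly_def det_def
    by (simp add: poly_sum poly_prod mat_def if_distrib[of "\<lambda>p. poly p x"] cong: if_cong)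
qed

lemma eigenvalue_iff_poly_charpoly:
  fixes A :: "real^'n::finite^'n"
  shows "(\<exists>v. v \<noteq> 0 \<and> A *v v = \<theta> *\<^sub>R v) \<longleftrightarrow> poly (charpoly A) \<theta> = 0"
proof -
  have "mat \<theta> *v v = \<theta> *\<^sub>R v" for v :: "real^'n"
    by (simp add: vec_eq_iff matrix_vector_mult_def mat_def if_distrib[of "\<lambda>c. c * _"] cong: if_cong)
  then have "(mat \<theta> - A) *v v = 0 \<longleftrightarrow> A *v v = \<theta> *\<^sub>R v" for v
    by (auto simp: matrix_vector_mult_diff_rdistrib)
  then show ?thesis
    unfolding poly_charpoly
    using invertible_det_nz[of "mat \<theta> - A"] matrix_left_invertible_ker[of "mat \<theta> - A"]
      invertible_left_inverse[of "mat \<theta> - A"] by auto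
qed

lemma second_largest_ge:
  fixes a b c :: "'a::linorder"
  assumes "{#a, b#} \<subseteq># M" "c \<le> a" "c \<le> b"
  shows "c \<le> rev (sorted_list_of_multiset M) ! 1"
proof -
  define xs where "xs = rev (sorted_list_of_multiset M)"
  have xs: "mset xs = M" by (simp add: xs_def)
  have sorted: "sorted_wrt (\<ge>) xs" by (simp add: xs_def sorted_wrt_rev)
  have "size {#a, b#} \<le> length xs"
    using size_mset_mono[OF assms(1)] by (simp flip: xs)
  then obtain x y ys where eq: "xs = x # y # ys"
    by (metis One_nat_def Suc_le_length_iff size_add_mset size_single numeral_2_eq_2)
  show ?thesis
  proof (rule ccontr)
    assume "\<not> ?thesis"
    then have "y < c" by (simp add: xs_def[symmetric] eq)
    then have "\<forall>z\<in>set (y # ys). \<not> c \<le> z"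
      using sorted by (force simp: eq)
    then have "filter_mset (\<lambda>z. c \<le> z) (mset (y # ys)) = {#}"
      by auto
    then have "size (filter_mset (\<lambda>z. c \<le> z) (mset xs)) \<le> 1" by (simp add: eq)
    moreover have "size (filter_mset (\<lambda>z. c \<le> z) {#a, b#}) \<le> size (filter_mset (\<lambda>z. c \<le> z) (mset xs))"
      unfolding xs by (intro size_mset_mono multiset_filter_mono assms(1))
    ultimately show False using assms(2,3) by simp
  qed
qed

lemma consensus_fixed_vector_constant:
  fixes W :: "real^'n::finite^'n"
  assumes E: "connected_graph E" and W: "consensus_matrix E W" and v: "W *v v = v"
  shows "v $ i = v $ j"
proof -
  have row: "(\<Sum>j\<in>UNIV. W $ i $ j) = 1" and col: "(\<Sum>i\<in>UNIV. W $ i $ j) = 1"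
    and nonneg: "0 \<le> W $ i $ j" for i j
    using W unfolding consensus_matrix_def doubly_stochastic_def by auto
  have Wv: "(\<Sum>j\<in>UNIV. W $ i $ j * v $ j) = v $ i" for i
    using arg_cong[OF v, of "\<lambda>u. u $ i"] by (simp add: matrix_vector_mult_def)
  have a: "(\<Sum>i\<in>UNIV. \<Sum>j\<in>UNIV. W $ i $ j * (v $ i * v $ i)) = (\<Sum>i\<in>UNIV. v $ i * v $ i)"
    by (simp add: row flip: sum_distrib_right)
  have b: "(\<Sum>i\<in>UNIV. \<Sum>j\<in>UNIV. W $ i $ j * (v $ j * v $ j)) = (\<Sum>i\<in>UNIV. v $ i * v $ i)"
    by (subst sum.swap) (simp add: col flip: sum_distrib_right)
  have c: "(\<Sum>i\<in>UNIV. \<Sum>j\<in>UNIV. W $ i $ j * (v $ i * v $ j)) = (\<Sum>i\<in>UNIV. v $ i * v $ i)"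
  proof (rule sum.cong[OF refl])
    fix i
    have "(\<Sum>j\<in>UNIV. W $ i $ j * (v $ i * v $ j)) = v $ i * (\<Sum>j\<in>UNIV. W $ i $ j * v $ j)"
      by (simp add: sum_distrib_left mult_ac)
    then show "(\<Sum>j\<in>UNIV. W $ i $ j * (v $ i * v $ j)) = v $ i * v $ i" by (simp add: Wv)
  qed
  have "(\<Sum>i\<in>UNIV. \<Sum>j\<in>UNIV. W $ i $ j * (v $ i - v $ j)\<^sup>2)
      = (\<Sum>i\<in>UNIV. \<Sum>j\<in>UNIV. W $ i $ j * (v $ i * v $ i) + W $ i $ j * (v $ j * v $ j)
          - 2 * (W $ i $ j * (v $ i * v $ j)))"
    by (intro sum.cong refl) (simp add: power2_eq_square algebra_simps)
  also have "\<dots> = 0"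
    by (simp add: sum_subtractf sum.distrib a b c flip: sum_distrib_left)
  finally have zero: "W $ i $ j * (v $ i - v $ j)\<^sup>2 = 0" for i j
    using nonneg by (simp add: sum_nonneg_eq_0_iff sum_nonneg)
  have "v $ i = v $ j" if "E i j" for i j
  proof -
    have "i \<noteq> j" using E that unfolding connected_graph_def irreflp_def by blast
    then have "W $ i $ j > 0" using W that unfolding consensus_matrix_def by blast
    then show ?thesis using zero[of i j] by simp
  qed
  note edge = this
  have "E\<^sup>*\<^sup>* i j" using E unfolding connected_graph_def by blast
  then show ?thesis by (induction rule: rtranclp_induct) (auto dest: edge)
qed

lemma consensus_eigenvalue_le:
  fixes W :: "real^'n::finite^'n"
  assumes E: "connected_graph E" and W: "consensus_matrix E W"
    and \<beta>: "second_largest_eigenvalue_magnitude W < 1"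
    and v: "W *v v = \<theta> *\<^sub>R v" "v \<noteq> 0" and sum0: "(\<Sum>i\<in>UNIV. v $ i) = 0"
  shows "\<bar>\<theta>\<bar> \<le> second_largest_eigenvalue_magnitude W"
proof -
  have ds: "doubly_stochastic W" using W unfolding consensus_matrix_def by blast
  \<comment> \<open>Connectedness makes \<open>1\<close> and \<open>\<theta>\<close> distinct roots of the characteristic polynomial, so that
    algebraic multiplicities do not matter.\<close>
  have "\<theta> \<noteq> 1"
  proof
    assume "\<theta> = 1"
    then have const: "v $ i = v $ j" for i j
      using consensus_fixed_vector_constant[OF E W] v by simp
    have "(\<Sum>i\<in>(UNIV :: 'n set). v $ j) = (\<Sum>i\<in>UNIV. v $ i)" for j
      by (intro sum.cong refl const)
    then have "v $ j = 0" for j using sum0 by simp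
    then show False using v(2) by (simp add: vec_eq_iff)
  qed
  have nz: "charpoly W \<noteq> 0"
  proof
    assume "charpoly W = 0"
    then obtain v where "v \<noteq> 0" "W *v v = 2 *\<^sub>R v"
      using eigenvalue_iff_poly_charpoly[of W 2] by auto
    then show False using stochastic_eigenvalue_le_1[OF ds] by fastforce
  qed
  have "W *v vec 1 = 1 *\<^sub>R vec 1"
    using ds by (simp add: vec_eq_iff matrix_vector_mult_def doubly_stochastic_def)
  moreover have "vec 1 \<noteq> (0 :: real^'n)" by (simp add: vec_eq_iff)
  ultimately have "poly (charpoly W) 1 = 0" using eigenvalue_iff_poly_charpoly by blast
  moreover have "poly (charpoly W) \<theta> = 0" using eigenvalue_iff_poly_charpoly v by blast
  ultimately have "{#1, \<theta>#} \<subseteq># real_eigenvalues W"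
    using nz \<open>\<theta> \<noteq> 1\<close> unfolding real_eigenvalues_def
    by (auto simp: subseteq_mset_def order_root Suc_le_eq)
  then have "{#1, \<bar>\<theta>\<bar>#} \<subseteq># image_mset abs (real_eigenvalues W)"
    using image_mset_subseteq_mono[of "{#1, \<theta>#}" _ abs] by simp
  then have "min 1 \<bar>\<theta>\<bar> \<le> second_largest_eigenvalue_magnitude W"
    unfolding second_largest_eigenvalue_magnitude_def by (rule second_largest_ge) auto
  then show ?thesis using \<beta> by linarith
qed

lemma inner_kronecker_self_adjoint:
  fixes W :: "real^'n::finite^'n" and x y :: "real^('n \<times> 'p::finite)"
  assumes "transpose W = W"
  shows "inner (kronecker W (mat 1) *v x) y = inner x (kronecker W (mat 1) *v y)"
proof -
  have sym: "W $ j $ i = W $ i $ j" for i j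
    using assms unfolding transpose_def by (metis vec_lambda_beta)
  have "inner (kronecker W (mat 1) *v x) y
      = (\<Sum>i\<in>UNIV. \<Sum>j\<in>UNIV. W $ i $ j * inner (block x j) (block y i))"
    by (simp add: inner_eq_sum_block block_kronecker_mat_1 inner_sum_left)
  also have "\<dots> = (\<Sum>j\<in>UNIV. \<Sum>i\<in>UNIV. W $ j $ i * inner (block x j) (block y i))"
    by (subst sum.swap) (simp add: sym[of i j for i j])
  also have "\<dots> = inner x (kronecker W (mat 1) *v y)"
    by (simp add: inner_eq_sum_block block_kronecker_mat_1 inner_sum_right)
  finally show ?thesis .
qed

lemma kronecker_eigenvector_column:
  fixes W :: "real^'n::finite^'n" and x :: "real^('n \<times> 'p::finite)"
  assumes "kronecker W (mat 1) *v x = \<theta> *\<^sub>R x"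
  shows "W *v (\<chi> i. x $ (i, l)) = \<theta> *\<^sub>R (\<chi> i. x $ (i, l))"
proof -
  have "(\<Sum>j\<in>UNIV. W $ i $ j *\<^sub>R block x j) $ l = (\<theta> *\<^sub>R block x i) $ l" for i
    using arg_cong[OF assms, of "\<lambda>z. block z i"] by (simp add: block_kronecker_mat_1)
  then show ?thesis
    by (simp add: vec_eq_iff matrix_vector_mult_def block_def)
qed

lemma block_mean_kronecker:
  fixes W :: "real^'n::finite^'n" and x :: "real^('n \<times> 'p::finite)"
  assumes "doubly_stochastic W"
  shows "block_mean (kronecker W (mat 1) *v x) = block_mean x"
proof -
  have "(\<Sum>i\<in>UNIV. \<Sum>j\<in>UNIV. W $ i $ j *\<^sub>R block x j) = (\<Sum>j\<in>UNIV. block x j)"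
    using assms by (subst sum.swap) (simp add: doubly_stochastic_def flip: scaleR_sum_left)
  then show ?thesis by (simp add: block_mean_def block_kronecker_mat_1)
qed

lemma kronecker_stack_const:
  fixes W :: "real^'n::finite^'n" and c :: "real^'p::finite"
  assumes "doubly_stochastic W"
  shows "kronecker W (mat 1) *v stack (\<lambda>_. c) = stack (\<lambda>_. c)"
  using assms
  by (intro block_vector_eqI)
    (simp add: block_kronecker_mat_1 doubly_stochastic_def flip: scaleR_sum_left)

lemma norm_kronecker_le:
  fixes W :: "real^'n::finite^'n" and x :: "real^('n \<times> 'p::finite)"
  assumes "doubly_stochastic W" "transpose W = W"
  shows "norm (kronecker W (mat 1) *v x) \<le> norm x"
proof -
  have "norm (kronecker W (mat 1) *v x) \<le> 1 * norm x"
  proof (rule self_adjoint_norm_le[where S = UNIV])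
    fix \<theta> and w :: "real^('n \<times> 'p)"
    assume w: "w \<noteq> 0" "kronecker W (mat 1) *v w = \<theta> *\<^sub>R w"
    then obtain i l where "w $ (i, l) \<noteq> 0" by (auto simp: vec_eq_iff)
    then have "(\<chi> i. w $ (i, l)) \<noteq> 0" by (auto simp: vec_eq_iff)
    then show "\<bar>\<theta>\<bar> \<le> 1"
      by (rule stochastic_eigenvalue_le_1[OF assms(1) kronecker_eigenvector_column[OF w(2)]])
  qed (auto simp: inner_kronecker_self_adjoint[OF assms(2)])
  then show ?thesis by simp
qed

lemma norm_kronecker_le_mean_zero:
  fixes W :: "real^'n::finite^'n" and x :: "real^('n \<times> 'p::finite)"
  assumes E: "connected_graph E" and W: "consensus_matrix E W"
    and \<beta>: "second_largest_eigenvalue_magnitude W < 1" and x: "block_mean x = 0"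
  shows "norm (kronecker W (mat 1) *v x) \<le> second_largest_eigenvalue_magnitude W * norm x"
proof (rule self_adjoint_norm_le[where S = "{x. block_mean x = 0}"])
  have ds: "doubly_stochastic W" and sym: "transpose W = W"
    using W unfolding consensus_matrix_def by auto
  show "inner (kronecker W (mat 1) *v x) y = inner x (kronecker W (mat 1) *v y)"
    for x y :: "real^('n \<times> 'p)"
    by (rule inner_kronecker_self_adjoint[OF sym])
  show "subspace {x :: real^('n \<times> 'p). block_mean x = 0}"
    by (auto simp: subspace_def block_mean_add block_mean_scaleR) (simp add: block_mean_def)
  show "x \<in> {x. block_mean x = 0} \<Longrightarrow> kronecker W (mat 1) *v x \<in> {x. block_mean x = 0}"
    for x :: "real^('n \<times> 'p)"
    by (simp add: block_mean_kronecker[OF ds])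
  fix \<theta> and w :: "real^('n \<times> 'p)"
  assume w: "w \<in> {x. block_mean x = 0}" "w \<noteq> 0" "kronecker W (mat 1) *v w = \<theta> *\<^sub>R w"
  then obtain i l where "w $ (i, l) \<noteq> 0" by (auto simp: vec_eq_iff)
  then have nz: "(\<chi> i. w $ (i, l)) \<noteq> 0" by (auto simp: vec_eq_iff)
  have "(\<Sum>i\<in>UNIV. block w i) = 0"
    using w(1) by (simp add: block_mean_def)
  then have "(\<Sum>i\<in>UNIV. w $ (i, l)) = 0"
    by (simp add: vec_eq_iff block_def)
  then show "\<bar>\<theta>\<bar> \<le> second_largest_eigenvalue_magnitude W"
    by (intro consensus_eigenvalue_le[OF E W \<beta> kronecker_eigenvector_column[OF w(3)] nz]) simp
qed (use x in auto)

lemma matpow_Suc_vector: "matpow A (Suc t) *v x = A *v (matpow A t *v x)"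
  for A :: "real^'n::finite^'n"
  by (simp add: matrix_vector_mul_assoc)

lemma block_mean_matpow_kronecker:
  assumes "doubly_stochastic W"
  shows "block_mean (matpow (kronecker W (mat 1)) t *v x) = block_mean x"
  by (induction t) (simp_all add: matpow_Suc_vector block_mean_kronecker[OF assms] del: matpow.simps(2))

lemma matpow_kronecker_stack_const:
  assumes "doubly_stochastic W"
  shows "matpow (kronecker W (mat 1)) t *v stack (\<lambda>_. c) = stack (\<lambda>_. c)"
  by (induction t) (simp_all add: matpow_Suc_vector kronecker_stack_const[OF assms] del: matpow.simps(2))

lemma norm_matpow_kronecker_le:
  fixes W :: "real^'n::finite^'n" and x :: "real^('n \<times> 'p::finite)"
  assumes "doubly_stochastic W" "transpose W = W"
  shows "norm (matpow (kronecker W (mat 1)) t *v x) \<le> norm x"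
proof (induction t)
  case (Suc t)
  then show ?case
    using norm_kronecker_le[OF assms, of "matpow (kronecker W (mat 1)) t *v x"]
    unfolding matpow_Suc_vector by linarith
qed simp

lemma norm_matpow_kronecker_diff_mean_le:
  fixes W :: "real^'n::finite^'n" and x :: "real^('n \<times> 'p::finite)"
  assumes E: "connected_graph E" and W: "consensus_matrix E W"
    and \<beta>: "0 \<le> second_largest_eigenvalue_magnitude W" "second_largest_eigenvalue_magnitude W < 1"
  shows "norm (matpow (kronecker W (mat 1)) t *v x - stack (\<lambda>_. block_mean x))
    \<le> second_largest_eigenvalue_magnitude W ^ t * norm x"
proof -
  define b where "b = second_largest_eigenvalue_magnitude W"
  have ds: "doubly_stochastic W" using W unfolding consensus_matrix_def by blast
  have pow: "norm (matpow (kronecker W (mat 1)) t *v z) \<le> b ^ t * norm z"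
    if "block_mean z = 0" for z :: "real^('n \<times> 'p)"
  proof (induction t)
    case (Suc t)
    have "norm (matpow (kronecker W (mat 1)) (Suc t) *v z)
        \<le> b * norm (matpow (kronecker W (mat 1)) t *v z)"
      unfolding matpow_Suc_vector b_def
      by (rule norm_kronecker_le_mean_zero[OF E W \<beta>(2)]) (simp add: block_mean_matpow_kronecker[OF ds] that)
    also have "\<dots> \<le> b * (b ^ t * norm z)"
      using Suc \<beta>(1) by (intro mult_left_mono) (auto simp: b_def)
    finally show ?case by (simp add: mult.assoc)
  qed simp
  have "matpow (kronecker W (mat 1)) t *v x - stack (\<lambda>_. block_mean x)
      = matpow (kronecker W (mat 1)) t *v (x - stack (\<lambda>_. block_mean x))"
    by (simp add: matrix_vector_mult_diff_distrib matpow_kronecker_stack_const[OF ds])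
  also have "norm \<dots> \<le> b ^ t * norm (x - stack (\<lambda>_. block_mean x))"
    by (rule pow) (simp add: block_mean_diff)
  also have "\<dots> \<le> b ^ t * norm x"
    using \<beta>(1) by (intro mult_left_mono norm_diff_block_mean_le) (simp add: b_def)
  finally show ?thesis by (simp add: b_def)
qed

section \<open>Local gradient descent\<close>

lemma bregman_bounds_lipschitz:
  fixes f :: "'a::real_inner \<Rightarrow> real"
  assumes "bregman_bounds 0 L f G" "0 < L"
  shows "norm (G x - G y) \<le> L * norm (x - y)"
proof -
  have "norm (G x - G y) \<le> norm (G x - G y - (L / 2) *\<^sub>R (x - y)) + norm ((L / 2) *\<^sub>R (x - y))"
    using norm_triangle_sub[of "G x - G y" "(L / 2) *\<^sub>R (x - y)"] by linarith
  then show ?thesis using cocoercive_ball[OF assms, of x y] assms(2) by simp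
qed

lemma one_minus_power_le:
  fixes c :: real
  assumes "0 \<le> c" "c \<le> 1"
  shows "1 - c ^ (n + 2) \<le> real (n + 2) / 2 * (1 - c\<^sup>2)"
proof (induction n rule: induct_nat_012)
  case 1
  have "0 \<le> (1 - c)\<^sup>2 * (1 + 2 * c)" using assms by simp
  then show ?case by (simp add: power2_eq_square power3_eq_cube algebra_simps)
next
  case (ge2 n)
  have "c\<^sup>2 * (1 - c ^ (n + 2)) \<le> 1 * (1 - c ^ (n + 2))"
    using assms by (intro mult_right_mono) (simp_all add: power_le_one del: power_Suc power_add_numeral2 add_2_eq_Suc')
  then show ?case
    using ge2.IH(1) by (simp add: power_add power2_eq_square algebra_simps)
qed (simp add: power2_eq_square)

lemma power_second_order_Bernoulli:
  fixes t :: real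
  assumes "0 \<le> t"
  shows "real n * (real n - 1) / 2 * t\<^sup>2 \<le> (1 + t) ^ n - 1 - real n * t"
proof (induction n)
  case (Suc n)
  have "t * (real n * t) \<le> t * ((1 + t) ^ n - 1)"
    using assms Bernoulli_inequality[of t n] by (intro mult_left_mono) auto
  then show ?case using Suc by (simp add: power2_eq_square field_simps)
qed simp

lemma perturbed_contraction_recursion:
  fixes e d :: "nat \<Rightarrow> real"
  assumes e: "\<And>j. j < m \<Longrightarrow> e (Suc j) \<le> c * e j + t * d j"
    and d: "\<And>j. Suc j < m \<Longrightarrow> d (Suc j) \<le> (1 + t) * d j + t * B"
    and "d 0 \<le> d0" "0 \<le> d0" "0 \<le> B" "0 \<le> t" "0 \<le> c" "c \<le> 1"
  shows "e m \<le> c ^ m * e 0 + d0 * ((1 + t) ^ m - 1) + B * ((1 + t) ^ m - 1 - real m * t)"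
proof -
  have dj: "d j \<le> d0 * (1 + t) ^ j + B * ((1 + t) ^ j - 1)" if "j < m" for j
    using that
  proof (induction j)
    case (Suc j)
    have "d (Suc j) \<le> (1 + t) * d j + t * B" using d Suc.prems by simp
    also have "\<dots> \<le> (1 + t) * (d0 * (1 + t) ^ j + B * ((1 + t) ^ j - 1)) + t * B"
      using Suc \<open>0 \<le> t\<close> by (intro add_mono mult_left_mono) auto
    finally show ?case by (simp add: algebra_simps)
  qed (use \<open>d 0 \<le> d0\<close> in simp)
  have "e j \<le> c ^ j * e 0 + (d0 * ((1 + t) ^ j - 1) + B * ((1 + t) ^ j - 1 - real j * t))" if "j \<le> m" for j
    using that
  proof (induction j)
    case (Suc j)
    define R where "R = d0 * ((1 + t) ^ j - 1) + B * ((1 + t) ^ j - 1 - real j * t)"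
    have "0 \<le> real j * t" using \<open>0 \<le> t\<close> by simp
    then have "0 \<le> (1 + t) ^ j - 1 - real j * t" "0 \<le> (1 + t) ^ j - 1"
      using \<open>0 \<le> t\<close> Bernoulli_inequality[of t j] by auto
    then have "0 \<le> R"
      unfolding R_def using \<open>0 \<le> d0\<close> \<open>0 \<le> B\<close> by (intro add_nonneg_nonneg mult_nonneg_nonneg)
    then have cR: "c * R \<le> 1 * R" using \<open>c \<le> 1\<close> by (intro mult_right_mono)
    have "e (Suc j) \<le> c * e j + t * d j" using e Suc.prems by simp
    also have "\<dots> \<le> c * (c ^ j * e 0 + R) + t * (d0 * (1 + t) ^ j + B * ((1 + t) ^ j - 1))"
      using Suc dj[of j] \<open>0 \<le> t\<close> \<open>0 \<le> c\<close> unfolding R_def by (intro add_mono mult_left_mono) auto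
    also have "\<dots> \<le> c ^ Suc j * e 0 + (R + t * (d0 * (1 + t) ^ j + B * ((1 + t) ^ j - 1)))"
      using cR by (simp add: algebra_simps)
    also have "R + t * (d0 * (1 + t) ^ j + B * ((1 + t) ^ j - 1))
        = d0 * ((1 + t) ^ Suc j - 1) + B * ((1 + t) ^ Suc j - 1 - real (Suc j) * t)"
      unfolding R_def by (simp add: algebra_simps)
    finally show ?case .
  qed simp
  from this[of m] show ?thesis by simp
qed

lemma delayed_geometric_recursion:
  fixes r :: "nat \<Rightarrow> real"
  assumes "r (Suc 0) \<le> q * r 0 + S / (1 - q)"
    and "\<And>k. r (Suc (Suc k)) \<le> q * r (Suc k) + S"
    and "0 \<le> q" "q < 1" "0 \<le> S"
  shows "r k \<le> q ^ k * r 0 + S / (1 - q)"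
proof (induction k rule: induct_nat_012)
  case 0
  show ?case using assms(4,5) by simp
next
  case 1
  show ?case using assms(1) by simp
next
  case (ge2 k)
  have "r (Suc (Suc k)) \<le> q * (q ^ Suc k * r 0 + S / (1 - q)) + S"
    using assms(2)[of k] mult_left_mono[OF ge2(2) assms(3)] by linarith
  also have "\<dots> = q ^ Suc (Suc k) * r 0 + S / (1 - q)"
    using assms(4) by (simp add: field_simps)
  finally show ?case .
qed

lemma norm_le_blockwise:
  fixes x y :: "real^('n::finite \<times> 'p::finite)"
  assumes "\<And>i. norm (block x i) \<le> c * norm (block y i)" "0 \<le> c"
  shows "norm x \<le> c * norm y"
proof (rule power2_le_imp_le)
  have "(norm x)\<^sup>2 \<le> (\<Sum>i\<in>UNIV. (c * norm (block y i))\<^sup>2)"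
    unfolding power2_norm_eq_sum_block using assms by (intro sum_mono power_mono) auto
  also have "\<dots> = (c * norm y)\<^sup>2"
    by (simp add: power_mult_distrib power2_norm_eq_sum_block sum_distrib_left)
  finally show "(norm x)\<^sup>2 \<le> (c * norm y)\<^sup>2" .
qed (use assms in simp)

definition dispersion :: "real^('n::finite \<times> 'p::finite) \<Rightarrow> real" where
  "dispersion x = (\<Sum>i\<in>UNIV. norm (block x i - block_mean x)) / real CARD('n)"

lemma dispersion_le:
  fixes x :: "real^('n::finite \<times> 'p::finite)"
  shows "dispersion x \<le> norm (x - stack (\<lambda>_. block_mean x))"
proof -
  have "dispersion x \<le> norm (x - stack (\<lambda>_. block_mean x)) / sqrt (real CARD('n))"
    using mean_norm_block_le[of "x - stack (\<lambda>_. block_mean x)"] by (simp add: dispersion_def)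
  also have "\<dots> \<le> norm (x - stack (\<lambda>_. block_mean x)) / 1"
    by (intro divide_left_mono) (simp_all add: Suc_le_eq)
  finally show ?thesis by simp
qed

locale local_gradient_descent =
  fixes f :: "'n::finite \<Rightarrow> real^'p::finite \<Rightarrow> real" and \<mu> l :: "'n \<Rightarrow> real" and \<alpha> L :: real
  assumes bounds: "bregman_bounds (\<mu> i) (l i) (f i) (gradient (f i))"
    and \<mu>_pos: "0 < \<mu> i" and l_le: "l i \<le> L"
    and \<alpha>_pos: "0 < \<alpha>" and \<alpha>_L: "\<alpha> * L \<le> 1"
begin

definition mean_gradient :: "real^'p \<Rightarrow> real^'p" where
  "mean_gradient z = (1 / real CARD('n)) *\<^sub>R (\<Sum>i\<in>UNIV. gradient (f i) z)"

definition \<mu>_mean where "\<mu>_mean = (\<Sum>i\<in>UNIV. \<mu> i) / real CARD('n)"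
definition l_mean where "l_mean = (\<Sum>i\<in>UNIV. l i) / real CARD('n)"

lemma \<mu>_le_l: "\<mu> i \<le> l i" and l_pos: "0 < l i" and L_pos: "0 < L"
  using bregman_bounds_le[OF bounds, of i] \<mu>_pos[of i] l_le[of i] by linarith+

lemma \<mu>_mean_pos: "0 < \<mu>_mean" and \<mu>_mean_le_l_mean: "\<mu>_mean \<le> l_mean" and l_mean_le: "l_mean \<le> L"
proof -
  show "0 < \<mu>_mean" using \<mu>_pos by (auto simp: \<mu>_mean_def intro!: divide_pos_pos sum_pos)
  show "\<mu>_mean \<le> l_mean"
    using \<mu>_le_l by (simp add: \<mu>_mean_def l_mean_def divide_right_mono sum_mono)
  have "(\<Sum>i\<in>UNIV. l i) \<le> real CARD('n) * L" using sum_bounded_above[of UNIV l L] l_le by simp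
  then show "l_mean \<le> L" by (simp add: l_mean_def field_simps)
qed

lemma bounds_mean:
  "bregman_bounds \<mu>_mean l_mean (\<lambda>x. 1 / real CARD('n) * (\<Sum>i\<in>UNIV. f i x)) mean_gradient"
  using bregman_bounds_scale[OF bregman_bounds_sum[where I = UNIV], of \<mu> l f "\<lambda>i. gradient (f i)" "1 / real CARD('n)"]
    bounds by (simp add: \<mu>_mean_def l_mean_def mean_gradient_def[abs_def])

lemma bounds_L: "bregman_bounds 0 L (f i) (gradient (f i))"
  using bregman_bounds_mono[OF bounds] \<mu>_pos l_le by (simp add: less_imp_le)

lemma bounds_mean_L:
  "bregman_bounds 0 L (\<lambda>x. 1 / real CARD('n) * (\<Sum>i\<in>UNIV. f i x)) mean_gradient"
  using bregman_bounds_mono[OF bounds_mean] \<mu>_mean_pos l_mean_le by (simp add: less_imp_le)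

lemma mean_gradient_minimizer:
  assumes "is_arg_min (\<lambda>x. \<Sum>i\<in>UNIV. f i x) (\<lambda>_. True) z"
  shows "mean_gradient z = 0"
proof (rule minimizer_imp_zero_gradient[OF bounds_mean_L L_pos])
  show "is_arg_min (\<lambda>x. 1 / real CARD('n) * (\<Sum>i\<in>UNIV. f i x)) (\<lambda>_. True) z"
    using assms by (simp add: is_arg_min_linorder divide_right_mono)
qed

lemma local_step_contraction:
  assumes "\<gamma> \<le> \<mu> i * l i / (\<mu> i + l i)" "0 \<le> \<gamma>" "\<alpha> * \<gamma> \<le> 1"
  shows "norm ((x - \<alpha> *\<^sub>R gradient (f i) x) - (y - \<alpha> *\<^sub>R gradient (f i) y)) \<le> (1 - \<alpha> * \<gamma>) * norm (x - y)"
proof (rule power2_le_imp_le)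
  have "\<alpha> \<le> 1 / L" using \<alpha>_L L_pos by (simp add: field_simps)
  also have "\<dots> \<le> 2 / (\<mu> i + l i)"
    using \<mu>_le_l[of i] l_le[of i] \<mu>_pos[of i] L_pos by (simp add: field_simps)
  finally have "(norm ((x - \<alpha> *\<^sub>R gradient (f i) x) - (y - \<alpha> *\<^sub>R gradient (f i) y)))\<^sup>2
      \<le> (1 - \<alpha> * (2 * \<mu> i * l i / (\<mu> i + l i))) * (norm (x - y))\<^sup>2"
    using gradient_step_contraction[OF bounds \<mu>_pos \<mu>_le_l] \<alpha>_pos by simp
  also have "\<dots> \<le> (1 - \<alpha> * \<gamma>)\<^sup>2 * (norm (x - y))\<^sup>2"
  proof (rule mult_right_mono)
    have "\<alpha> * (2 * \<gamma>) \<le> \<alpha> * (2 * \<mu> i * l i / (\<mu> i + l i))"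
      using assms(1) \<alpha>_pos by (intro mult_left_mono) auto
    moreover have "(1 - \<alpha> * \<gamma>)\<^sup>2 = 1 - \<alpha> * (2 * \<gamma>) + (\<alpha> * \<gamma>)\<^sup>2"
      by (simp add: power2_diff)
    ultimately show "1 - \<alpha> * (2 * \<mu> i * l i / (\<mu> i + l i)) \<le> (1 - \<alpha> * \<gamma>)\<^sup>2"
      using zero_le_power2[of "\<alpha> * \<gamma>"] by linarith
  qed simp
  finally show "(norm ((x - \<alpha> *\<^sub>R gradient (f i) x) - (y - \<alpha> *\<^sub>R gradient (f i) y)))\<^sup>2
      \<le> ((1 - \<alpha> * \<gamma>) * norm (x - y))\<^sup>2"
    by (simp add: power_mult_distrib)
qed (use assms in simp)

lemma local_step_nonexpansive:
  "norm ((x - \<alpha> *\<^sub>R gradient (f i) x) - (y - \<alpha> *\<^sub>R gradient (f i) y)) \<le> norm (x - y)"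
  using local_step_contraction[of 0 i x y] \<mu>_pos[of i] l_pos[of i] by simp

lemma local_step_expansion_le:
  "(1 - \<alpha> * L) * norm (x - y) \<le> norm ((x - \<alpha> *\<^sub>R gradient (f i) x) - (y - \<alpha> *\<^sub>R gradient (f i) y))"
proof -
  define d where "d = gradient (f i) x - gradient (f i) y"
  have "norm (\<alpha> *\<^sub>R d) \<le> \<alpha> * (L * norm (x - y))"
    using bregman_bounds_lipschitz[OF bounds_L L_pos, of i x y] \<alpha>_pos by (simp add: d_def)
  moreover have "norm (x - y) - norm (\<alpha> *\<^sub>R d) \<le> norm ((x - y) - \<alpha> *\<^sub>R d)"
    by (rule norm_triangle_ineq2)
  moreover have "(x - y) - \<alpha> *\<^sub>R d = (x - \<alpha> *\<^sub>R gradient (f i) x) - (y - \<alpha> *\<^sub>R gradient (f i) y)"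
    by (simp add: d_def algebra_simps)
  moreover have "(1 - \<alpha> * L) * norm (x - y) = norm (x - y) - \<alpha> * (L * norm (x - y))"
    by (simp add: algebra_simps)
  ultimately show ?thesis by simp
qed

lemma block_gradient_step:
  "block (gradient_step f \<alpha> x) i = block x i - \<alpha> *\<^sub>R gradient (f i) (block x i)"
  by (simp add: gradient_step_def)

lemma block_mean_gradient_step:
  "block_mean (gradient_step f \<alpha> x)
    = block_mean x - \<alpha> *\<^sub>R ((1 / real CARD('n)) *\<^sub>R (\<Sum>i\<in>UNIV. gradient (f i) (block x i)))"
  by (simp add: block_mean_def block_gradient_step sum_subtractf scaleR_diff_right
      flip: scaleR_sum_right)

lemma norm_mean_gradient_diff_le:
  "norm (mean_gradient (block_mean x) - (1 / real CARD('n)) *\<^sub>R (\<Sum>i\<in>UNIV. gradient (f i) (block x i)))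
    \<le> L * dispersion x"
proof -
  have "mean_gradient (block_mean x) - (1 / real CARD('n)) *\<^sub>R (\<Sum>i\<in>UNIV. gradient (f i) (block x i))
      = (1 / real CARD('n)) *\<^sub>R (\<Sum>i\<in>UNIV. gradient (f i) (block_mean x) - gradient (f i) (block x i))"
    by (simp add: mean_gradient_def sum_subtractf scaleR_diff_right)
  also have "norm \<dots> \<le> (\<Sum>i\<in>UNIV. L * norm (block x i - block_mean x)) / real CARD('n)"
    using bregman_bounds_lipschitz[OF bounds_L L_pos]
    by (auto intro!: divide_right_mono order_trans[OF norm_sum] sum_mono simp: norm_minus_commute[of "block x _"])
  finally show ?thesis by (simp add: dispersion_def flip: sum_distrib_left)
qed

lemma norm_block_mean_step_le:
  assumes z: "mean_gradient z = 0" and \<alpha>: "\<alpha> \<le> 2 / (\<mu>_mean + l_mean)"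
  shows "norm (block_mean (gradient_step f \<alpha> x) - z)
    \<le> sqrt (1 - \<alpha> * (2 * \<mu>_mean * l_mean / (\<mu>_mean + l_mean))) * norm (block_mean x - z)
      + \<alpha> * L * dispersion x"
proof -
  define m h where "m = block_mean x" and "h = (1 / real CARD('n)) *\<^sub>R (\<Sum>i\<in>UNIV. gradient (f i) (block x i))"
  have "(norm ((m - \<alpha> *\<^sub>R mean_gradient m) - (z - \<alpha> *\<^sub>R mean_gradient z)))\<^sup>2
      \<le> (1 - \<alpha> * (2 * \<mu>_mean * l_mean / (\<mu>_mean + l_mean))) * (norm (m - z))\<^sup>2"
    using gradient_step_contraction[OF bounds_mean \<mu>_mean_pos \<mu>_mean_le_l_mean _ \<alpha>] \<alpha>_pos by simp
  from real_le_rsqrt[OF this]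
  have contr: "norm ((m - \<alpha> *\<^sub>R mean_gradient m) - z)
      \<le> sqrt (1 - \<alpha> * (2 * \<mu>_mean * l_mean / (\<mu>_mean + l_mean))) * norm (m - z)"
    by (simp add: z real_sqrt_mult)
  have "block_mean (gradient_step f \<alpha> x) - z
      = ((m - \<alpha> *\<^sub>R mean_gradient m) - z) + \<alpha> *\<^sub>R (mean_gradient m - h)"
    by (simp add: block_mean_gradient_step m_def h_def scaleR_diff_right)
  also have "norm \<dots> \<le> norm ((m - \<alpha> *\<^sub>R mean_gradient m) - z) + \<alpha> * norm (mean_gradient m - h)"
    using \<alpha>_pos by (intro order_trans[OF norm_triangle_ineq]) simp
  also have "\<dots> \<le> norm ((m - \<alpha> *\<^sub>R mean_gradient m) - z) + \<alpha> * (L * dispersion x)"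
    using norm_mean_gradient_diff_le[of x] \<alpha>_pos by (simp add: m_def h_def)
  finally show ?thesis using contr by (simp add: m_def)
qed

lemma norm_gradient_minus_mean_gradient_le:
  assumes z: "mean_gradient z = 0"
  shows "norm (gradient (f i) m - mean_gradient m) \<le> L * norm (m - z) + norm (gradient (f i) z)"
proof -
  define a where "a = gradient (f i) m - gradient (f i) z - (L / 2) *\<^sub>R (m - z)"
  define b where "b = mean_gradient m - mean_gradient z - (L / 2) *\<^sub>R (m - z)"
  have "norm a \<le> L / 2 * norm (m - z)" "norm b \<le> L / 2 * norm (m - z)"
    unfolding a_def b_def by (intro cocoercive_ball[OF bounds_L L_pos] cocoercive_ball[OF bounds_mean_L L_pos])+
  moreover have "gradient (f i) m - mean_gradient m = (a - b) + gradient (f i) z"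
    by (simp add: a_def b_def z)
  then have "norm (gradient (f i) m - mean_gradient m) \<le> norm a + norm b + norm (gradient (f i) z)"
    using norm_triangle_ineq[of "a - b" "gradient (f i) z"] norm_triangle_ineq4[of a b] by simp
  ultimately show ?thesis by simp
qed

lemma dispersion_step_le:
  assumes z: "mean_gradient z = 0"
  shows "dispersion (gradient_step f \<alpha> x)
    \<le> (1 + \<alpha> * L) * dispersion x
      + \<alpha> * (L * norm (block_mean x - z) + (\<Sum>i\<in>UNIV. norm (gradient (f i) z)) / real CARD('n))"
proof -
  define m h where "m = block_mean x" and "h = (1 / real CARD('n)) *\<^sub>R (\<Sum>i\<in>UNIV. gradient (f i) (block x i))"
  define r where "r = norm (m - z)"
  have "norm (block (gradient_step f \<alpha> x) i - block_mean (gradient_step f \<alpha> x))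
      \<le> norm (block x i - m) + \<alpha> * norm (gradient (f i) z) + (\<alpha> * (L * r) + \<alpha> * (L * dispersion x))" for i
  proof -
    define a where "a = (block x i - \<alpha> *\<^sub>R gradient (f i) (block x i)) - (m - \<alpha> *\<^sub>R gradient (f i) m)"
    have "block (gradient_step f \<alpha> x) i - block_mean (gradient_step f \<alpha> x)
        = a - \<alpha> *\<^sub>R (gradient (f i) m - mean_gradient m) - \<alpha> *\<^sub>R (mean_gradient m - h)"
      by (simp add: block_gradient_step block_mean_gradient_step a_def m_def h_def scaleR_diff_right)
    also have "norm \<dots> \<le> norm a + norm (\<alpha> *\<^sub>R (gradient (f i) m - mean_gradient m))
        + norm (\<alpha> *\<^sub>R (mean_gradient m - h))"
      by (meson norm_triangle_ineq4 order_trans add_right_mono)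
    also have "\<dots> = norm a + \<alpha> * norm (gradient (f i) m - mean_gradient m) + \<alpha> * norm (mean_gradient m - h)"
      using \<alpha>_pos by simp
    also have "\<dots> \<le> norm (block x i - m) + \<alpha> * (L * r + norm (gradient (f i) z)) + \<alpha> * (L * dispersion x)"
      unfolding a_def r_def using \<alpha>_pos norm_mean_gradient_diff_le[of x]
      by (intro add_mono mult_left_mono local_step_nonexpansive
          norm_gradient_minus_mean_gradient_le[OF z]) (simp_all add: m_def h_def)
    finally show ?thesis by (simp add: algebra_simps)
  qed
  then have "(\<Sum>i\<in>UNIV. norm (block (gradient_step f \<alpha> x) i - block_mean (gradient_step f \<alpha> x)))
      \<le> (\<Sum>i\<in>UNIV. norm (block x i - m) + \<alpha> * norm (gradient (f i) z) + (\<alpha> * (L * r) + \<alpha> * (L * dispersion x)))"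
    by (rule sum_mono)
  also have "\<dots> = (\<Sum>i\<in>UNIV. norm (block x i - m)) + \<alpha> * (\<Sum>i\<in>UNIV. norm (gradient (f i) z))
      + real CARD('n) * (\<alpha> * (L * r) + \<alpha> * (L * dispersion x))"
    by (simp add: sum.distrib distrib_left flip: sum_distrib_left)
  finally have "dispersion (gradient_step f \<alpha> x) \<le> \<dots> / real CARD('n)"
    unfolding dispersion_def[of "gradient_step f \<alpha> x"] by (rule divide_right_mono) simp
  also have "\<dots> = dispersion x + \<alpha> * ((\<Sum>i\<in>UNIV. norm (gradient (f i) z)) / real CARD('n))
      + (\<alpha> * (L * r) + \<alpha> * (L * dispersion x))"
    by (simp add: dispersion_def[of x] m_def add_divide_distrib)
  finally show ?thesis by (simp add: r_def m_def algebra_simps)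
qed

lemma norm_block_mean_iterate_le:
  assumes z: "mean_gradient z = 0" and \<alpha>: "\<alpha> \<le> 2 / (\<mu>_mean + l_mean)"
    and c: "c = sqrt (1 - \<alpha> * (2 * \<mu>_mean * l_mean / (\<mu>_mean + l_mean)))" "0 \<le> c" "c \<le> 1"
    and d0: "dispersion x \<le> d0" "0 \<le> d0" and "0 \<le> B"
    and B: "\<And>j. Suc j < m \<Longrightarrow> L * norm (block_mean ((gradient_step f \<alpha> ^^ j) x) - z)
      + (\<Sum>i\<in>UNIV. norm (gradient (f i) z)) / real CARD('n) \<le> L * B"
  shows "norm (block_mean ((gradient_step f \<alpha> ^^ m) x) - z)
    \<le> c ^ m * norm (block_mean x - z) + d0 * ((1 + \<alpha> * L) ^ m - 1)
      + B * ((1 + \<alpha> * L) ^ m - 1 - real m * (\<alpha> * L))"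
proof -
  define X where "X j = (gradient_step f \<alpha> ^^ j) x" for j
  have X: "X (Suc j) = gradient_step f \<alpha> (X j)" for j by (simp add: X_def)
  have "norm (block_mean (X m) - z)
    \<le> c ^ m * norm (block_mean (X 0) - z) + d0 * ((1 + \<alpha> * L) ^ m - 1)
      + B * ((1 + \<alpha> * L) ^ m - 1 - real m * (\<alpha> * L))"
  proof (rule perturbed_contraction_recursion[where e = "\<lambda>j. norm (block_mean (X j) - z)"
        and d = "\<lambda>j. dispersion (X j)" and c = c and t = "\<alpha> * L" and B = B])
    show "norm (block_mean (X (Suc j)) - z) \<le> c * norm (block_mean (X j) - z) + \<alpha> * L * dispersion (X j)" for j
      unfolding X c(1) by (rule norm_block_mean_step_le[OF z \<alpha>])
    fix j assume "Suc j < m"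
    have "dispersion (X (Suc j)) \<le> (1 + \<alpha> * L) * dispersion (X j)
        + \<alpha> * (L * norm (block_mean (X j) - z) + (\<Sum>i\<in>UNIV. norm (gradient (f i) z)) / real CARD('n))"
      unfolding X by (rule dispersion_step_le[OF z])
    also have "\<dots> \<le> (1 + \<alpha> * L) * dispersion (X j) + \<alpha> * (L * B)"
      using B[OF \<open>Suc j < m\<close>] \<alpha>_pos unfolding X_def by (intro add_left_mono mult_left_mono) auto
    finally show "dispersion (X (Suc j)) \<le> (1 + \<alpha> * L) * dispersion (X j) + \<alpha> * L * B"
      by (simp add: mult.assoc)
  qed (use d0 c \<open>0 \<le> B\<close> \<alpha>_pos L_pos in \<open>simp_all add: X_def\<close>)
  then show ?thesis by (simp add: X_def)
qed

lemma norm_iterate_minus_fixed_le: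
  assumes u: "\<And>i. gradient (f i) (u i) = 0"
    and \<gamma>: "\<And>i. \<gamma> \<le> \<mu> i * l i / (\<mu> i + l i)" "0 \<le> \<gamma>" "\<alpha> * \<gamma> \<le> 1"
  shows "norm ((gradient_step f \<alpha> ^^ j) x - stack u) \<le> (1 - \<alpha> * \<gamma>) ^ j * norm (x - stack u)"
proof (induction j)
  case (Suc j)
  have "norm (gradient_step f \<alpha> y - stack u) \<le> (1 - \<alpha> * \<gamma>) * norm (y - stack u)" for y
  proof (rule norm_le_blockwise)
    show "norm (block (gradient_step f \<alpha> y - stack u) i) \<le> (1 - \<alpha> * \<gamma>) * norm (block (y - stack u) i)" for i
      using local_step_contraction[OF \<gamma>(1)[of i] \<gamma>(2,3), of "block y i" "u i"]
      by (simp add: block_gradient_step u)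
  qed (use \<gamma> in simp)
  then have "norm ((gradient_step f \<alpha> ^^ Suc j) x - stack u)
      \<le> (1 - \<alpha> * \<gamma>) * norm ((gradient_step f \<alpha> ^^ j) x - stack u)" by simp
  also have "\<dots> \<le> (1 - \<alpha> * \<gamma>) * ((1 - \<alpha> * \<gamma>) ^ j * norm (x - stack u))"
    using Suc \<gamma>(3) by (intro mult_left_mono) auto
  finally show ?case by (simp add: mult.assoc)
qed simp

lemma norm_minus_fixed_le_iterate:
  assumes u: "\<And>i. gradient (f i) (u i) = 0" and "\<alpha> * L < 1"
  shows "(1 - \<alpha> * L) ^ j * norm (x - stack u) \<le> norm ((gradient_step f \<alpha> ^^ j) x - stack u)"
proof (induction j)
  case (Suc j)
  have pos: "1 - \<alpha> * L > 0" using assms(2) by simp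
  have "norm (y - stack u) \<le> 1 / (1 - \<alpha> * L) * norm (gradient_step f \<alpha> y - stack u)" for y
  proof (rule norm_le_blockwise)
    show "norm (block (y - stack u) i) \<le> 1 / (1 - \<alpha> * L) * norm (block (gradient_step f \<alpha> y - stack u) i)" for i
      using local_step_expansion_le[of "block y i" "u i" i] pos
      by (simp add: block_gradient_step u pos_le_divide_eq mult.commute)
  qed (use pos in simp)
  then have "(1 - \<alpha> * L) * norm (y - stack u) \<le> norm (gradient_step f \<alpha> y - stack u)" for y
    using pos by (simp add: pos_le_divide_eq mult.commute)
  then have "(1 - \<alpha> * L) * norm ((gradient_step f \<alpha> ^^ j) x - stack u)
      \<le> norm ((gradient_step f \<alpha> ^^ Suc j) x - stack u)" by simp
  moreover have "(1 - \<alpha> * L) * ((1 - \<alpha> * L) ^ j * norm (x - stack u))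
      \<le> (1 - \<alpha> * L) * norm ((gradient_step f \<alpha> ^^ j) x - stack u)"
    using Suc pos by (intro mult_left_mono) auto
  ultimately show ?case by (simp add: mult.assoc)
qed simp

end

section \<open>Error bound\<close>

theorem mainTheorem1:
  fixes f :: "'n::finite \<Rightarrow> real^'p::finite \<Rightarrow> real"
    and L\<^sub>i \<mu>\<^sub>i :: "'n \<Rightarrow> real"
    and E :: "'n \<Rightarrow> 'n \<Rightarrow> bool" and W :: "real^'n^'n"
    and t\<^sub>c t\<^sub>g :: nat and s\<^sub>0 x_star :: "real^'p" and u_star :: "'n \<Rightarrow> real^'p"
    and \<alpha> \<beta> L \<mu>\<^sub>f L\<^sub>f \<gamma> \<nu> D D_hat M \<eta> c\<^sub>1 c\<^sub>2 c\<^sub>3 c\<^sub>4 c\<^sub>5 :: real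
  assumes "1 \<le> t\<^sub>c" and "1 \<le> t\<^sub>g"
    and "\<And>i. convex_on UNIV (f i)"
    and "\<And>i x. f i differentiable (at x)"
    and "\<And>i. 0 < L\<^sub>i i" and "\<And>i. (L\<^sub>i i)-lipschitz_on UNIV (gradient (f i))"
    and "\<And>i. 0 < \<mu>\<^sub>i i" and "\<And>i. strongly_convex (\<mu>\<^sub>i i) (f i)"
    and "connected_graph E" and "consensus_matrix E W"
    and "\<beta> = second_largest_eigenvalue_magnitude W" and "0 < \<beta>" and "\<beta> < 1"
    and "L = Max (range L\<^sub>i)"
    and "\<mu>\<^sub>f = (\<Sum>i\<in>UNIV. \<mu>\<^sub>i i) / real CARD('n)"
    and "L\<^sub>f = (\<Sum>i\<in>UNIV. L\<^sub>i i) / real CARD('n)"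
    and "is_arg_min (\<lambda>x. \<Sum>i\<in>UNIV. f i x) (\<lambda>_. True) x_star"
    and "\<And>i. is_arg_min (f i) (\<lambda>_. True) (u_star i)"
    and "\<gamma> = Min (range (\<lambda>i. \<mu>\<^sub>i i * L\<^sub>i i / (\<mu>\<^sub>i i + L\<^sub>i i)))"
    and "\<nu> = 2 * \<alpha> * \<gamma>"
    and "D = norm (near_dgd_y f W \<alpha> t\<^sub>c t\<^sub>g s\<^sub>0 0 - stack u_star)
               + (\<nu> + 4) / \<nu> * norm (stack u_star)"
    and "D_hat = norm x_star + D / sqrt (real CARD('n))"
    and "M = 2 * L * D_hat + (\<Sum>i\<in>UNIV. norm (gradient (f i) x_star))"
    and "\<eta> = 1 + \<alpha> * L"
    and "c\<^sub>2 = 2 * \<mu>\<^sub>f * L\<^sub>f / (\<mu>\<^sub>f + L\<^sub>f)"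
    and "c\<^sub>1 = sqrt (1 - \<alpha> * c\<^sub>2)"
    and "c\<^sub>3 = \<alpha> * D * L / (\<eta> - 1)"
    and "c\<^sub>4 = 2 / (\<mu>\<^sub>f + L\<^sub>f)"
    and "c\<^sub>5 = \<alpha> * M / (\<eta> - 1)"
    and "0 < \<alpha>" and "\<alpha> \<le> min (1 / L) c\<^sub>4"
  shows "\<forall>k. norm (block_mean (near_dgd f W \<alpha> t\<^sub>c t\<^sub>g s\<^sub>0 k) - x_star)
    \<le> c\<^sub>1 ^ (k * t\<^sub>g) * norm (block_mean (near_dgd f W \<alpha> t\<^sub>c t\<^sub>g s\<^sub>0 0) - x_star)
      + c\<^sub>3 * \<beta> ^ t\<^sub>c * (\<eta> ^ t\<^sub>g - 1) / (1 - c\<^sub>1 ^ t\<^sub>g)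
      + c\<^sub>5 * ((\<eta> ^ t\<^sub>g - 1 - real t\<^sub>g * (\<eta> - 1)) / (1 - c\<^sub>1 ^ t\<^sub>g))"
proof -
  note tg = assms(2) and \<mu>_pos = assms(7) and \<beta> = assms(11-13)
    and \<gamma>_def = assms(19) and \<nu>_def = assms(20) and D_def = assms(21) and D_hat_def = assms(22)
    and M_def = assms(23) and \<eta>_def = assms(24) and c\<^sub>2_def = assms(25) and c\<^sub>1_def = assms(26)
  have \<alpha>_pos: "0 < \<alpha>" and \<alpha>_le: "\<alpha> \<le> 1 / L" "\<alpha> \<le> 2 / (\<mu>\<^sub>f + L\<^sub>f)"
    using assms(28,30,31) by auto
  have l_le: "L\<^sub>i i \<le> L" for i
    unfolding assms(14) by (rule Max_ge) auto
  have L_pos: "0 < L" using assms(5) l_le by (meson less_le_trans)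
  define t where "t = \<alpha> * L"
  have t: "0 < t" "t \<le> 1"
    using \<alpha>_pos \<alpha>_le(1) L_pos by (simp_all add: t_def field_simps)
  interpret local_gradient_descent f \<mu>\<^sub>i L\<^sub>i \<alpha> L
    by unfold_locales
      (use bregman_bounds_gradient[OF assms(8) assms(4) assms(6)] \<mu>_pos l_le \<alpha>_pos t in \<open>simp_all add: t_def\<close>)
  have means: "\<mu>_mean = \<mu>\<^sub>f" "l_mean = L\<^sub>f"
    by (simp_all add: \<mu>_mean_def l_mean_def assms(15,16))
  have x_star: "mean_gradient x_star = 0"
    by (rule mean_gradient_minimizer) (rule assms(17))
  have u_star: "gradient (f i) (u_star i) = 0" for i
    by (rule minimizer_imp_zero_gradient[OF bounds_L L_pos assms(18)])

  define T X Y u where "T = gradient_step f \<alpha>" and "X k = near_dgd f W \<alpha> t\<^sub>c t\<^sub>g s\<^sub>0 k"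
    and "Y k = (T ^^ t\<^sub>g) (X k)" and "u = stack u_star" for k
  define N P where "N = real CARD('n)" and "P = (\<Sum>i\<in>UNIV. norm (gradient (f i) x_star))"
  have N: "1 \<le> N" by (simp add: N_def Suc_le_eq)
  have P: "0 \<le> P" by (simp add: P_def sum_nonneg)
  have P_div: "P / N \<le> P"
    using divide_left_mono[OF N P] N by simp
  have X_Suc: "X (Suc k) = matpow (kronecker W (mat 1)) t\<^sub>c *v Y k" for k
    by (simp add: X_def Y_def T_def)
  have ds: "doubly_stochastic W" and sym: "transpose W = W"
    using assms(10) unfolding consensus_matrix_def by auto
  have mean_X_Suc: "block_mean (X (Suc k)) = block_mean (Y k)" for k
    by (simp add: X_Suc block_mean_matpow_kronecker[OF ds])

  have \<gamma>_le: "\<gamma> \<le> \<mu>\<^sub>i i * L\<^sub>i i / (\<mu>\<^sub>i i + L\<^sub>i i)" for i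
    unfolding \<gamma>_def by (rule Min_le) auto
  have "\<gamma> \<in> range (\<lambda>i. \<mu>\<^sub>i i * L\<^sub>i i / (\<mu>\<^sub>i i + L\<^sub>i i))"
    unfolding \<gamma>_def by (rule Min_in) auto
  then obtain i where i: "\<gamma> = \<mu>\<^sub>i i * L\<^sub>i i / (\<mu>\<^sub>i i + L\<^sub>i i)" by blast
  have "0 < \<gamma>" unfolding i using \<mu>_pos[of i] l_pos[of i] by simp
  have "2 * \<gamma> \<le> L\<^sub>i i"
  proof -
    have "2 * \<mu>\<^sub>i i * L\<^sub>i i \<le> (\<mu>\<^sub>i i + L\<^sub>i i) * L\<^sub>i i"
      using \<mu>_le_l[of i] l_pos[of i] by (intro mult_right_mono) auto
    then show ?thesis using \<mu>_pos[of i] l_pos[of i] by (simp add: i divide_le_eq mult.commute)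
  qed
  then have "\<alpha> * (2 * \<gamma>) \<le> \<alpha> * L" using l_le[of i] \<alpha>_pos by (intro mult_left_mono) auto
  then have \<nu>: "0 < \<nu>" "\<nu> \<le> 1" and \<alpha>\<gamma>: "\<alpha> * \<gamma> = \<nu> / 2"
    using t(2) \<alpha>_pos \<open>0 < \<gamma>\<close> unfolding \<nu>_def t_def by (simp, linarith, simp)
  have to_u: "norm ((T ^^ j) x - u) \<le> (1 - \<nu> / 2) ^ j * norm (x - u)" for j x
    using norm_iterate_minus_fixed_le[of u_star \<gamma> j x] u_star \<gamma>_le \<open>0 < \<gamma>\<close> \<nu>
    by (simp add: T_def u_def \<alpha>\<gamma>)
  have to_u': "norm ((T ^^ j) x - u) \<le> norm (x - u)" for j x
  proof -
    have "(1 - \<nu> / 2) ^ j * norm (x - u) \<le> 1 * norm (x - u)"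
      using \<nu> by (intro mult_right_mono power_le_one) auto
    then show ?thesis using to_u[of j x] by linarith
  qed

  define U where "U = norm u"
  have D_eq: "D = norm (Y 0 - u) + U + 4 / \<nu> * U"
  proof -
    have "(\<nu> + 4) / \<nu> = 1 + 4 / \<nu>" using \<nu> by (simp add: add_divide_distrib)
    then show ?thesis
      unfolding D_def near_dgd_y_def Y_def X_def T_def u_def U_def by (simp add: distrib_right)
  qed
  have four: "4 * U \<le> 4 / \<nu> * U"
    using \<nu> by (intro mult_right_mono) (simp_all add: U_def field_simps)
  have U: "0 \<le> U" by (simp add: U_def)
  have X_u: "norm (X (Suc k) - u) \<le> norm (Y k - u) + 2 * U" for k
  proof -
    have "X (Suc k) - u = matpow (kronecker W (mat 1)) t\<^sub>c *v (Y k - u) + (matpow (kronecker W (mat 1)) t\<^sub>c *v u - u)"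
      by (simp add: X_Suc matrix_vector_mult_diff_distrib)
    also have "norm \<dots> \<le> norm (matpow (kronecker W (mat 1)) t\<^sub>c *v (Y k - u))
        + (norm (matpow (kronecker W (mat 1)) t\<^sub>c *v u) + norm u)"
      by (meson norm_triangle_ineq norm_triangle_ineq4 add_left_mono order_trans)
    finally show ?thesis
      using norm_matpow_kronecker_le[OF ds sym, of t\<^sub>c "Y k - u"] norm_matpow_kronecker_le[OF ds sym, of t\<^sub>c u]
      by (simp add: U_def)
  qed
  have Y_u: "norm (Y k - u) \<le> norm (Y 0 - u) + 4 / \<nu> * U - 2 * U" for k
  proof (induction k)
    case 0
    show ?case using four U by simp
  next
    case (Suc k)
    have "norm (Y (Suc k) - u) \<le> (1 - \<nu> / 2) ^ t\<^sub>g * norm (X (Suc k) - u)"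
      unfolding Y_def by (rule to_u)
    also have "\<dots> \<le> (1 - \<nu> / 2) ^ 1 * norm (X (Suc k) - u)"
      using \<nu> tg by (intro mult_right_mono power_decreasing) auto
    also have "\<dots> \<le> (1 - \<nu> / 2) * (norm (Y 0 - u) + 4 / \<nu> * U)"
      using X_u[of k] Suc \<nu> by (simp add: mult_left_mono)
    also have "\<dots> = (1 - \<nu> / 2) * norm (Y 0 - u) + (4 / \<nu> * U - 2 * U)"
      using \<nu> by (simp add: field_simps)
    also have "\<dots> \<le> 1 * norm (Y 0 - u) + (4 / \<nu> * U - 2 * U)"
      using \<nu> by (intro add_right_mono mult_right_mono) auto
    finally show ?case by simp
  qed
  have norm_via_u: "norm x \<le> norm (x - u) + U" for x
    unfolding U_def using norm_triangle_sub[of x u] by (simp add: add.commute)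
  have Y_le_D: "norm (Y k) \<le> D" for k
    using norm_via_u[of "Y k"] Y_u[of k] U by (simp add: D_eq)
  have iterates_le_D: "norm ((T ^^ j) (X (Suc k))) \<le> D" for j k
    using norm_via_u[of "(T ^^ j) (X (Suc k))"] to_u'[of j "X (Suc k)"] X_u[of k] Y_u[of k]
    by (simp add: D_eq)
  have D_nonneg: "0 \<le> D" using Y_le_D[of 0] norm_ge_zero order_trans by blast
  have mean_le: "norm (block_mean x - x_star) \<le> norm x_star + norm x / sqrt N" for x :: "real^('n \<times> 'p)"
    using norm_block_mean_le[of x] norm_triangle_ineq4[of "block_mean x" x_star] by (simp add: N_def)
  have mean_le_D_hat: "norm (block_mean x - x_star) \<le> D_hat" if "norm x \<le> D" for x :: "real^('n \<times> 'p)"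
    using mean_le[of x] divide_right_mono[OF that, of "sqrt N"] N by (simp add: D_hat_def N_def)
  have D_hat_nonneg: "0 \<le> D_hat" using D_nonneg by (simp add: D_hat_def)
  have M: "M = 2 * L * D_hat + P" by (simp add: M_def P_def)
  have M_nonneg: "0 \<le> M" using P L_pos D_hat_nonneg by (simp add: M)

  have c2: "\<alpha> * c\<^sub>2 = \<alpha> * (2 * \<mu>_mean * l_mean / (\<mu>_mean + l_mean))"
    by (simp add: c\<^sub>2_def means)
  have c2_pos: "0 < \<alpha> * c\<^sub>2"
    unfolding c2 using \<alpha>_pos \<mu>_mean_pos \<mu>_mean_le_l_mean by simp
  have c2_le: "\<alpha> * c\<^sub>2 \<le> t"
  proof -
    have "2 * \<mu>_mean * l_mean \<le> (\<mu>_mean + l_mean) * l_mean"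
      using \<mu>_mean_pos \<mu>_mean_le_l_mean by (intro mult_right_mono) auto
    then have "c\<^sub>2 \<le> l_mean"
      using \<mu>_mean_pos \<mu>_mean_le_l_mean by (simp add: c\<^sub>2_def divide_le_eq mult.commute flip: means)
    then show ?thesis using \<alpha>_pos l_mean_le by (simp add: t_def)
  qed
  have c1: "0 \<le> c\<^sub>1" "c\<^sub>1 < 1" "1 - c\<^sub>1\<^sup>2 \<le> t"
    using c2_pos c2_le t by (simp_all add: c\<^sub>1_def)
  have c1': "c\<^sub>1 = sqrt (1 - \<alpha> * (2 * \<mu>_mean * l_mean / (\<mu>_mean + l_mean)))"
    unfolding c\<^sub>1_def c2 ..
  define q where "q = c\<^sub>1 ^ t\<^sub>g"
  have q: "0 \<le> q" "q < 1"
    using c1 tg by (simp_all add: q_def power_less_one_iff)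

  define E1 E2 where "E1 = \<eta> ^ t\<^sub>g - 1" and "E2 = \<eta> ^ t\<^sub>g - 1 - real t\<^sub>g * t"
  have \<eta>: "\<eta> = 1 + t" by (simp add: \<eta>_def t_def)
  have E2: "real t\<^sub>g * (real t\<^sub>g - 1) / 2 * t\<^sup>2 \<le> E2"
    unfolding E2_def \<eta> using t by (intro power_second_order_Bernoulli) simp
  moreover have "0 \<le> real t\<^sub>g * (real t\<^sub>g - 1) / 2 * t\<^sup>2" using tg by simp
  ultimately have E2_nonneg: "0 \<le> E2" by linarith
  have E1_nonneg: "0 \<le> E1" using t by (simp add: E1_def \<eta>)
  define S where "S = D * \<beta> ^ t\<^sub>c * E1 + M / L * E2"
  have S: "0 \<le> D * \<beta> ^ t\<^sub>c * E1" "0 \<le> M / L * E2"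
    using D_nonneg \<beta> E1_nonneg E2_nonneg M_nonneg L_pos by simp_all

  define r where "r k = norm (block_mean (X k) - x_star)" for k
  have r_Suc: "r (Suc k) \<le> q * r k + d0 * E1 + B * E2"
    if "dispersion (X k) \<le> d0" "0 \<le> d0" "0 \<le> B"
      "\<And>j. Suc j < t\<^sub>g \<Longrightarrow> L * norm (block_mean ((T ^^ j) (X k)) - x_star) + P / N \<le> L * B" for k d0 B
    using norm_block_mean_iterate_le[OF x_star _ c1' c1(1) _ that(1-3), of t\<^sub>g] that(4) \<alpha>_le(2) c1(2)
    unfolding means by (simp add: r_def mean_X_Suc Y_def T_def q_def E1_def E2_def \<eta> t_def N_def P_def)

  have step: "r (Suc (Suc k)) \<le> q * r (Suc k) + S" for k
  proof -
    have "dispersion (X (Suc k)) \<le> norm (X (Suc k) - stack (\<lambda>_. block_mean (Y k)))"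
      using dispersion_le[of "X (Suc k)"] by (simp add: mean_X_Suc)
    also have "\<dots> \<le> \<beta> ^ t\<^sub>c * norm (Y k)"
      unfolding X_Suc \<beta>(1)
      using norm_matpow_kronecker_diff_mean_le[OF assms(9,10), of t\<^sub>c "Y k"] \<beta> by simp
    also have "\<dots> \<le> \<beta> ^ t\<^sub>c * D"
      using Y_le_D \<beta> by (intro mult_left_mono) auto
    finally have "dispersion (X (Suc k)) \<le> D * \<beta> ^ t\<^sub>c" by (simp add: mult.commute)
    then have "r (Suc (Suc k)) \<le> q * r (Suc k) + D * \<beta> ^ t\<^sub>c * E1 + M / L * E2"
    proof (rule r_Suc)
      fix j
      have "L * norm (block_mean ((T ^^ j) (X (Suc k))) - x_star) \<le> L * D_hat"
        using mean_le_D_hat[OF iterates_le_D] L_pos by simp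
      moreover have "0 \<le> L * D_hat" using L_pos D_hat_nonneg by simp
      ultimately have "L * norm (block_mean ((T ^^ j) (X (Suc k))) - x_star) + P / N \<le> M"
        using P_div unfolding M by linarith
      then show "L * norm (block_mean ((T ^^ j) (X (Suc k))) - x_star) + P / N \<le> L * (M / L)"
        using L_pos by simp
    qed (use D_nonneg \<beta> M_nonneg L_pos in simp_all)
    then show ?thesis by (simp add: S_def)
  qed

  have "dispersion (X 0) \<le> 0"
    by (simp add: dispersion_def X_def)
  note r_1 = r_Suc[OF this order_refl]
  have bound_1: "M / L * E2 / (1 - q) \<le> S / (1 - q)" "0 \<le> S / (1 - q)"
    using S q unfolding S_def by (intro divide_right_mono divide_nonneg_nonneg; linarith)+
  have first: "r (Suc 0) \<le> q * r 0 + S / (1 - q)"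
  proof (cases "t\<^sub>g = 1")
    case True
    then show ?thesis using r_1[of 0] bound_1(2) by simp
  next
    case False
    then obtain m where m: "t\<^sub>g = m + 2" using tg by (metis Suc_1 add.commute le_Suc_ex le_antisym not_less_eq_eq)
    have "1 - q \<le> real t\<^sub>g / 2 * (1 - c\<^sub>1\<^sup>2)"
      unfolding q_def m using c1 by (intro one_minus_power_le) auto
    also have "\<dots> \<le> real t\<^sub>g / 2 * t" using c1(3) by (intro mult_left_mono) auto
    finally have q_le: "1 - q \<le> real t\<^sub>g / 2 * t" .
    show ?thesis
    proof (cases "1 \<le> 2 * (real t\<^sub>g - 1) * t")
      case True
      have "D_hat * (1 - q) \<le> D_hat * (real t\<^sub>g / 2 * t * 1)"
        using q_le D_hat_nonneg by (intro mult_left_mono) auto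
      also have "\<dots> \<le> D_hat * (real t\<^sub>g / 2 * t * (2 * (real t\<^sub>g - 1) * t))"
        using True t D_hat_nonneg by (intro mult_left_mono) auto
      also have "\<dots> = 2 * D_hat * (real t\<^sub>g * (real t\<^sub>g - 1) / 2 * t\<^sup>2)"
        by (simp add: power2_eq_square)
      also have "\<dots> \<le> 2 * D_hat * E2"
        using E2 D_hat_nonneg by (intro mult_left_mono) auto
      also have "\<dots> \<le> M / L * E2"
        using E2_nonneg P L_pos by (intro mult_right_mono) (simp_all add: M field_simps)
      finally have "D_hat \<le> M / L * E2 / (1 - q)"
        using q by (intro mult_imp_le_div_pos) simp_all
      moreover have "r (Suc 0) \<le> D_hat"
        unfolding r_def mean_X_Suc by (rule mean_le_D_hat[OF Y_le_D])
      moreover have "0 \<le> q * r 0" using q by (simp add: r_def)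
      ultimately show ?thesis using bound_1(1) by linarith
    next
      case False
      have t_less: "t < 1 / 2"
      proof -
        have "1 * t \<le> (real t\<^sub>g - 1) * t" using t by (intro mult_right_mono) (auto simp: m)
        then show ?thesis using False by linarith
      qed
      have q_le': "1 - q \<le> 2 * (1 - t) ^ t\<^sub>g"
      proof (cases "m = 0")
        case True
        have "0 \<le> (2 - t) * (1 - 2 * t)" using t_less t by simp
        then have "t \<le> 2 * (1 - t)\<^sup>2" by (simp add: power2_eq_square algebra_simps)
        then show ?thesis using q_le by (simp add: m True power2_eq_square)
      next
        case False
        have "real t\<^sub>g * t \<le> (3 / 2 * (real t\<^sub>g - 1)) * t"
          using False t by (intro mult_right_mono) (auto simp: m)
        then have "real t\<^sub>g * t \<le> 3 / 4"
          using \<open>\<not> 1 \<le> 2 * (real t\<^sub>g - 1) * t\<close> by linarith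
        moreover have "1 + real t\<^sub>g * (- t) \<le> (1 + (- t)) ^ t\<^sub>g"
          using t by (intro Bernoulli_inequality) simp
        ultimately show ?thesis using q_le by simp
      qed
      have "r (Suc 0) \<le> q * r 0 + 0 * E1 + M / L / (1 - q) * E2"
      proof (rule r_1)
        fix j assume j: "Suc j < t\<^sub>g"
        define x where "x = (T ^^ j) (X 0)"
        have "Y 0 = (T ^^ (t\<^sub>g - j)) x"
          using funpow_add[of "t\<^sub>g - j" j T] j by (simp add: Y_def x_def)
        then have "(1 - t) ^ (t\<^sub>g - j) * norm (x - u) \<le> norm (Y 0 - u)"
          using norm_minus_fixed_le_iterate[of u_star "t\<^sub>g - j" x] u_star t_less
          by (simp add: t_def u_def T_def)
        moreover have "(1 - t) ^ t\<^sub>g * norm (x - u) \<le> (1 - t) ^ (t\<^sub>g - j) * norm (x - u)"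
          using t by (intro mult_right_mono power_decreasing) auto
        moreover have "(1 - q) * norm (x - u) \<le> 2 * (1 - t) ^ t\<^sub>g * norm (x - u)"
          using q_le' by (intro mult_right_mono) auto
        ultimately have "(1 - q) * norm (x - u) \<le> 2 * norm (Y 0 - u)" by simp
        moreover have "(1 - q) * U \<le> 1 * U" using q U by (intro mult_right_mono) auto
        moreover have "(1 - q) * norm x \<le> (1 - q) * (norm (x - u) + U)"
          using q norm_via_u by (intro mult_left_mono) auto
        ultimately have x: "(1 - q) * norm x \<le> 2 * D"
          using four U by (simp add: D_eq distrib_left)
        have "(1 - q) * norm (block_mean x - x_star) \<le> (1 - q) * (norm x_star + norm x / sqrt N)"
          using mean_le q by (intro mult_left_mono) auto
        also have "\<dots> = (1 - q) * norm x_star + (1 - q) * norm x / sqrt N"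
          by (simp add: distrib_left)
        also have "\<dots> \<le> 2 * norm x_star + 2 * D / sqrt N"
          using x q N by (intro add_mono divide_right_mono mult_right_mono) auto
        also have "\<dots> = 2 * D_hat" by (simp add: D_hat_def N_def)
        finally have "L * ((1 - q) * norm (block_mean x - x_star)) \<le> L * (2 * D_hat)"
          using L_pos by (intro mult_left_mono) auto
        moreover have "(1 - q) * (P / N) \<le> 1 * P"
          using q P P_div N by (intro mult_mono) auto
        ultimately have "(L * norm (block_mean x - x_star) + P / N) * (1 - q) \<le> M"
          unfolding M by (simp add: algebra_simps)
        then have "L * norm (block_mean x - x_star) + P / N \<le> M / (1 - q)"
          using q by (simp add: pos_le_divide_eq)
        then show "L * norm (block_mean ((T ^^ j) (X 0)) - x_star) + P / N \<le> L * (M / L / (1 - q))"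
          using L_pos by (simp add: x_def)
      qed (use M_nonneg L_pos q in simp)
      then show ?thesis using bound_1(1) by simp
    qed
  qed

  have S_nonneg: "0 \<le> S" using S by (simp add: S_def)
  have "S / (1 - q) = c\<^sub>3 * \<beta> ^ t\<^sub>c * (\<eta> ^ t\<^sub>g - 1) / (1 - c\<^sub>1 ^ t\<^sub>g)
      + c\<^sub>5 * ((\<eta> ^ t\<^sub>g - 1 - real t\<^sub>g * (\<eta> - 1)) / (1 - c\<^sub>1 ^ t\<^sub>g))"
  proof -
    have "c\<^sub>3 = D" "c\<^sub>5 = M / L"
      using \<alpha>_pos L_pos by (simp_all add: assms(27,29) \<eta>_def)
    then show ?thesis by (simp add: S_def E1_def E2_def q_def \<eta> add_divide_distrib)
  qed
  moreover have "r k \<le> q ^ k * r 0 + S / (1 - q)" for k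
    by (rule delayed_geometric_recursion[OF first step q S_nonneg])
  moreover have "q ^ k = c\<^sub>1 ^ (k * t\<^sub>g)" for k
    by (simp add: q_def mult.commute flip: power_mult)
  ultimately show ?thesis
    unfolding r_def X_def by (simp add: add.assoc)
qed

end
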